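(* Let $\Bbbk$ be a field, let $P=\Bbbk\langle a,b,c,d,x,y\rangle$ be augmented by sending each generator to $0$, and let $A_0=P/(e_0,e_1)$ with the induced augmentation, where $e_0=(1+a)(1+c)-(1+d)(1+y)$ and $e_1=(1+a)(1+b)(1+c)-(1+d)(1+x)(1+y)$. Let $I(A_0)$ be the augmentation ideal of $A_0$. Then the series of transfinite powers $\{I(A_0)^\alpha\}$ has transfinite length $\omega^2$.
   Context: All algebras are associative unital $\Bbbk$-algebras and all ideals are two-sided; the augmentation ideal is the kernel of the augmentation $A_0\to\Bbbk$. For an ideal $I$ of an algebra $B$, the transfinite powers $I^\alpha$, indexed by ordinals, are defined recursively by $I^0=B$, $I^{\alpha+1}=I^\alpha\cdot I+I\cdot I^\alpha$, and $I^\alpha=\bigcap_{\beta<\alpha}I^\beta$ for (nonzero) limit ordinals $\alpha$. The transfinite length of $\{I^\alpha\}$ is the least ordinal $\alpha$ such that $I^\alpha=I^{\alpha+1}$. *)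

theory Defs
  imports
    "HOL-Library.Poly_Mapping"
    "HOL-Algebra.Ideal_Product"
    "HOL-Algebra.QuotRing"
    "HOL-Algebra.Algebraic_Closure_Type"
begin

unbundle cardinal_syntax

section \<open>Free associative algebras\<close>

text \<open>
  The free monoid on \<open>'g\<close>, written additively: \<^typ>\<open>'m \<Rightarrow>\<^sub>0 'k\<close> is the
  monoid algebra of an additively written monoid \<open>'m\<close>.
\<close>

datatype 'g word = Word (letters: "'g list")

instantiation word :: (type) monoid_add
begin

definition zero_word :: "'a word" where "0 = Word []"

definition plus_word :: "'a word \<Rightarrow> 'a word \<Rightarrow> 'a word" where
  "u + v = Word (letters u @ letters v)"

instance
  by standard (simp_all add: zero_word_def plus_word_def)

end

type_synonym ('g, 'k) free_algebra = "'g word \<Rightarrow>\<^sub>0 'k"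

definition gen :: "'g \<Rightarrow> ('g, 'k::field) free_algebra" where
  "gen g = Poly_Mapping.single (Word [g]) 1"

definition scalar :: "'k::field \<Rightarrow> ('g, 'k) free_algebra" where
  "scalar c = Poly_Mapping.single 0 c"

text \<open>The \<open>'k\<close>-algebra homomorphism to \<open>'k\<close> that sends the generator \<open>g\<close> to \<open>f g\<close>.\<close>

definition eval_free :: "('g \<Rightarrow> 'k::field) \<Rightarrow> ('g, 'k) free_algebra \<Rightarrow> 'k" where
  "eval_free f p =
     (\<Sum>w \<in> Poly_Mapping.keys p. Poly_Mapping.lookup p w * prod_list (map f (letters w)))"

lemma eval_free_superset:
  assumes "finite S" "Poly_Mapping.keys p \<subseteq> S"
  shows "eval_free f p = (\<Sum>w\<in>S. Poly_Mapping.lookup p w * prod_list (map f (letters w)))"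
  unfolding eval_free_def
  by (rule sum.mono_neutral_left) (use assms in \<open>auto simp: in_keys_iff\<close>)

lemma eval_free_single:
  "eval_free f (Poly_Mapping.single w c) = c * prod_list (map f (letters w))"
  by (subst eval_free_superset[of "{w}"]) (auto simp: lookup_single)

lemma eval_free_0 [simp]: "eval_free f 0 = 0"
  by (simp add: eval_free_def)

lemma eval_free_add: "eval_free f (p + q) = eval_free f p + eval_free f q"
proof -
  let ?S = "Poly_Mapping.keys p \<union> Poly_Mapping.keys q"
  have "Poly_Mapping.keys (p + q) \<subseteq> ?S"
    by (rule Poly_Mapping.keys_add)
  then show ?thesis
    by (simp add: eval_free_superset[of ?S] lookup_add sum.distrib distrib_right)
qed

lemma eval_free_uminus: "eval_free f (- p) = - eval_free f p"
  using eval_free_add[of f p "- p"] by (simp add: minus_unique)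

lemma eval_free_diff: "eval_free f (p - q) = eval_free f p - eval_free f q"
  using eval_free_add[of f p "- q"] by (simp add: eval_free_uminus)

lemma free_algebra_induct [case_names zero add]:
  fixes p :: "('g, 'k::field) free_algebra"
  assumes "P 0" "\<And>w c p. P p \<Longrightarrow> P (Poly_Mapping.single w c + p)"
  shows "P p"
proof (induction p rule: Poly_Mapping.update_induct)
  case (update p w c)
  have "Poly_Mapping.update w c p = Poly_Mapping.single w c + p"
    using update(1)
    by (intro poly_mapping_eqI) (auto simp: lookup_update lookup_add lookup_single in_keys_iff when_def)
  with assms(2) update show ?case by simp
qed (rule assms(1))

lemma eval_free_mult: "eval_free f (p * q) = eval_free f p * eval_free f q"
proof (induction p rule: free_algebra_induct)
  case (add w c p)
  have "eval_free f (Poly_Mapping.single w c * q) =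
        eval_free f (Poly_Mapping.single w c) * eval_free f q"
    by (induction q rule: free_algebra_induct)
      (simp_all add: eval_free_add distrib_left mult_single eval_free_single plus_word_def)
  with add show ?case
    by (simp add: distrib_right eval_free_add)
qed simp

lemma eval_free_scalar: "eval_free f (scalar c) = c"
  by (simp add: scalar_def eval_free_single zero_word_def)

lemma eval_free_1 [simp]: "eval_free f 1 = 1"
  using eval_free_scalar[of f 1] by (simp add: scalar_def)

lemma eval_free_gen: "eval_free f (gen g) = f g"
  by (simp add: gen_def eval_free_single)


section \<open>Ordinals and transfinite powers\<close>

text \<open>
  As in the \<open>BNF_Wellorder\<close> theories, an ordinal is represented by a well-order \<open>r\<close> (a relation,
  well-ordering \<^term>\<open>Field r\<close>) up to \<^term>\<open>(=o)\<close>.  The smaller ordinals are represented by the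
  proper initial segments \<open>init_seg r x\<close>; \<open>r\<close> is a successor iff its field has a maximum \<open>m\<close>, and it
  is then the successor of \<open>init_seg r m\<close>.
\<close>

definition init_seg :: "'o rel \<Rightarrow> 'o \<Rightarrow> 'o rel" where
  "init_seg r x = Restr r (underS r x)"

definition is_max :: "'o rel \<Rightarrow> 'o \<Rightarrow> bool" where
  "is_max r m \<longleftrightarrow> m \<in> Field r \<and> (\<forall>x \<in> Field r. (x, m) \<in> r)"

definition ord_suc :: "'o rel \<Rightarrow> 'o option rel" where
  "ord_suc r = map_prod Some Some ` r \<union> insert None (Some ` Field r) \<times> {None}"

definition omega_squared :: "(nat \<times> nat) rel" where
  "omega_squared = {((i, j), (i', j')). i < i' \<or> i = i' \<and> j \<le> j'}"

text \<open>
  \<open>transfinite_power R I r\<close> is the power \<open>I\<^sup>\<alpha>\<close> in \<open>R\<close> for \<open>\<alpha>\<close> the order type of \<open>r\<close>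
  (see \<open>transfinite_power_ordIso\<close>).  Relations that are not well-orders are excluded only to make
  the recursion terminate.
\<close>

function transfinite_power :: "('a, 'b) ring_scheme \<Rightarrow> 'a set \<Rightarrow> 'o rel \<Rightarrow> 'a set" where
  "transfinite_power R I r =
    (if \<not> Well_order r then undefined
     else if Field r = {} then carrier R
     else if \<exists>m. is_max r m then
       (let J = transfinite_power R I (init_seg r (THE m. is_max r m))
        in (J \<cdot>\<^bsub>R\<^esub> I) <+>\<^bsub>R\<^esub> (I \<cdot>\<^bsub>R\<^esub> J))
     else (\<Inter>x \<in> Field r. transfinite_power R I (init_seg r x)))"
  by pat_completeness auto

lemma is_max_unique:
  assumes "Well_order r" "is_max r m" "is_max r m'"
  shows "m = m'"
  using assms unfolding is_max_def order_on_defs antisym_def by blast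

lemma the_is_max:
  assumes "Well_order r" "is_max r m"
  shows "(THE m. is_max r m) = m"
  using is_max_unique[OF assms(1) _ assms(2)] assms(2) by (rule the_equality[rotated])

lemma init_seg_ordLess:
  assumes "Well_order r" "x \<in> Field r"
  shows "init_seg r x <o r"
  unfolding init_seg_def using assms by (intro underS_Restr_ordLess) auto

termination
proof (relation "inv_image ordLess (\<lambda>(R, I, r). r)")
  show "wf (inv_image ordLess (\<lambda>(R, I, r). r))"
    by (rule wf_inv_image, rule wf_ordLess)
qed (auto simp: the_is_max is_max_def intro!: init_seg_ordLess)

declare transfinite_power.simps [simp del]

lemma transfinite_power_zero:
  assumes "Well_order r" "Field r = {}"
  shows "transfinite_power R I r = carrier R"
  using assms by (simp add: transfinite_power.simps[of R I r])

lemma transfinite_power_max: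
  assumes "Well_order r" "is_max r m"
  shows "transfinite_power R I r =
           (let J = transfinite_power R I (init_seg r m) in (J \<cdot>\<^bsub>R\<^esub> I) <+>\<^bsub>R\<^esub> (I \<cdot>\<^bsub>R\<^esub> J))"
proof -
  have "Field r \<noteq> {}" "\<exists>m. is_max r m"
    using assms(2) by (auto simp: is_max_def)
  then show ?thesis
    using assms(1) unfolding transfinite_power.simps[of R I r] the_is_max[OF assms] by auto
qed

lemma transfinite_power_limit:
  assumes "Well_order r" "Field r \<noteq> {}" "\<nexists>m. is_max r m"
  shows "transfinite_power R I r = (\<Inter>x \<in> Field r. transfinite_power R I (init_seg r x))"
  using assms unfolding transfinite_power.simps[of R I r] by auto

lemma Field_init_seg:
  assumes "Well_order r"
  shows "Field (init_seg r x) = underS r x"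
proof -
  have "Refl r"
    using assms by (simp add: order_on_defs)
  then show ?thesis
    unfolding init_seg_def
    by (rule Refl_Field_Restr2) (auto simp: underS_def Field_def)
qed

lemma Well_order_init_seg: "Well_order r \<Longrightarrow> Well_order (init_seg r x)"
  unfolding init_seg_def by (rule Well_order_Restr)

lemma init_seg_ordIso:
  assumes r: "Well_order r" and s: "Well_order s" and f: "BNF_Wellorder_Embedding.iso r s f" and x: "x \<in> Field r"
  shows "init_seg r x =o init_seg s (f x)"
proof -
  have bij: "bij_betw f (Field r) (Field s)"
    and rel: "\<And>a b. a \<in> Field r \<Longrightarrow> b \<in> Field r \<Longrightarrow> (a, b) \<in> r \<longleftrightarrow> (f a, f b) \<in> s"
    using f unfolding iso_iff2 by auto
  have sub: "underS r x \<subseteq> Field r" "underS s (f x) \<subseteq> Field s"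
    by (auto simp: underS_def Field_def)
  have inj: "inj_on f (Field r)" and img: "f ` Field r = Field s"
    using bij by (auto simp: bij_betw_def)
  have "f ` underS r x = underS s (f x)"
  proof (intro equalityI subsetI)
    fix y assume "y \<in> f ` underS r x"
    then obtain z where z: "z \<in> underS r x" "y = f z" by blast
    then have "z \<in> Field r" using sub by blast
    then show "y \<in> underS s (f x)"
      using z x rel[of z x] inj by (auto simp: underS_def inj_on_eq_iff)
  next
    fix y assume y: "y \<in> underS s (f x)"
    then obtain z where z: "z \<in> Field r" "y = f z" using sub img by blast
    then have "z \<in> underS r x"
      using y x rel[of z x] by (auto simp: underS_def)
    then show "y \<in> f ` underS r x" using z by blast
  qed
  then have "bij_betw f (underS r x) (underS s (f x))"
    using inj_on_subset[OF inj sub(1)] by (simp add: bij_betw_def)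
  moreover have "(a, b) \<in> init_seg r x \<longleftrightarrow> (f a, f b) \<in> init_seg s (f x)"
    if "a \<in> underS r x" "b \<in> underS r x" for a b
    using that sub rel[of a b] \<open>f ` underS r x = underS s (f x)\<close> unfolding init_seg_def by blast
  ultimately have "BNF_Wellorder_Embedding.iso (init_seg r x) (init_seg s (f x)) f"
    unfolding iso_iff2 Field_init_seg[OF r] Field_init_seg[OF s] by blast
  then show ?thesis
    unfolding ordIso_def using Well_order_init_seg[OF r] Well_order_init_seg[OF s] by blast
qed

lemma iso_is_max:
  assumes "BNF_Wellorder_Embedding.iso r s f" "is_max r m"
  shows "is_max s (f m)"
  using assms unfolding iso_iff2 is_max_def bij_betw_def by (metis imageE imageI)

theorem transfinite_power_ordIso:
  fixes r :: "'o rel" and s :: "'p rel"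
  assumes "r =o s"
  shows "transfinite_power R I r = transfinite_power R I s"
  using assms
proof (induction r arbitrary: s rule: wf_induct_rule[OF wf_ordLess])
  case (1 r)
  obtain f where r: "Well_order r" and s: "Well_order s" and f: "BNF_Wellorder_Embedding.iso r s f"
    using 1(2) unfolding ordIso_def by auto
  have img: "Field s = f ` Field r"
    using f by (metis iso_Field)
  have IH: "transfinite_power R I (init_seg r x) = transfinite_power R I (init_seg s (f x))"
    if "x \<in> Field r" for x
    using 1(1)[OF init_seg_ordLess[OF r that] init_seg_ordIso[OF r s f that]] .
  have max: "(\<exists>m. is_max r m) \<longleftrightarrow> (\<exists>m. is_max s m)"
  proof
    assume "\<exists>m. is_max s m"
    then obtain m where m: "is_max s m" by blast
    obtain g where g: "BNF_Wellorder_Embedding.iso s r g"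
      using ordIso_symmetric[OF 1(2)] unfolding ordIso_def by auto
    show "\<exists>m. is_max r m" using iso_is_max[OF g m] by blast
  next
    assume "\<exists>m. is_max r m"
    then obtain m where m: "is_max r m" by blast
    show "\<exists>m. is_max s m" using iso_is_max[OF f m] by blast
  qed
  show ?case
  proof (cases "\<exists>m. is_max r m")
    case True
    then obtain m where m: "is_max r m" by blast
    have "m \<in> Field r" using m by (simp add: is_max_def)
    then show ?thesis
      by (simp add: transfinite_power_max[OF r m] transfinite_power_max[OF s iso_is_max[OF f m]] IH)
  next
    case False
    then have s_max: "\<nexists>m. is_max s m" using max by blast
    show ?thesis
    proof (cases "Field r = {}")
      case True
      then show ?thesis using img r s by (simp add: transfinite_power_zero)
    next
      case nonempty: False
      then have "Field s \<noteq> {}" using img by simp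
      then show ?thesis
        unfolding transfinite_power_limit[OF r nonempty False]
          transfinite_power_limit[OF s \<open>Field s \<noteq> {}\<close> s_max] img
        by (simp add: IH)
    qed
  qed
qed

lemma Field_ord_suc: "Field (ord_suc r) = insert None (Some ` Field r)"
  unfolding ord_suc_def Field_def by force

lemma Well_order_ord_suc:
  assumes "Well_order r"
  shows "Well_order (ord_suc r)"
proof -
  have "Linear_order (ord_suc r)"
  proof -
    have r: "refl_on (Field r) r" "trans r" "antisym r" "total_on (Field r) r"
      using assms by (simp_all add: order_on_defs)
    have iff: "(Some a, Some b) \<in> ord_suc r \<longleftrightarrow> (a, b) \<in> r"
      "(Some a, None) \<in> ord_suc r \<longleftrightarrow> a \<in> Field r"
      "(None, Some b) \<notin> ord_suc r" "(None, None) \<in> ord_suc r" for a b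
      by (auto simp: ord_suc_def)
    have Field: "a \<in> Field r" if "(a, b) \<in> r" for a b
      using that by (auto simp: Field_def)
    have "Refl (ord_suc r)"
      using r(1) by (auto simp: Field_ord_suc refl_on_def iff)
    moreover have "trans (ord_suc r)"
    proof (rule transI)
      fix x y z assume "(x, y) \<in> ord_suc r" "(y, z) \<in> ord_suc r"
      then show "(x, z) \<in> ord_suc r"
        by (cases x; cases y; cases z) (auto simp: iff dest: Field transD[OF r(2)])
    qed
    moreover have "antisym (ord_suc r)"
    proof (rule antisymI)
      fix x y assume "(x, y) \<in> ord_suc r" "(y, x) \<in> ord_suc r"
      then show "x = y"
        by (cases x; cases y) (auto simp: iff dest: antisymD[OF r(3)])
    qed
    moreover have "Total (ord_suc r)"
      using r(4) by (auto simp: Field_ord_suc total_on_def iff)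
    ultimately show ?thesis
      by (auto simp: order_on_defs Field_def)
  qed
  moreover have "wf (ord_suc r - Id)"
  proof (rule wfUNIVI)
    fix P :: "'a option \<Rightarrow> bool" and z
    assume step: "\<forall>x. (\<forall>y. (y, x) \<in> ord_suc r - Id \<longrightarrow> P y) \<longrightarrow> P x"
    have "wf (r - Id)"
      using assms by (simp add: well_order_on_def)
    then have Some: "P (Some a)" for a
    proof (induction a rule: wf_induct_rule)
      case (less a)
      show ?case
        by (rule step[rule_format]) (auto simp: ord_suc_def intro: less)
    qed
    show "P z"
    proof (cases z)
      case None
      show ?thesis
        unfolding None by (rule step[rule_format]) (auto simp: ord_suc_def intro: Some)
    qed (simp add: Some)
  qed
  ultimately show ?thesis
    by (simp add: well_order_on_def)
qed

lemma is_max_ord_suc: "is_max (ord_suc r) None"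
  unfolding is_max_def Field_ord_suc by (auto simp: ord_suc_def)

lemma init_seg_ord_suc:
  assumes "Well_order r"
  shows "r =o init_seg (ord_suc r) None"
proof -
  have seg: "init_seg (ord_suc r) None = map_prod Some Some ` r"
    by (auto simp: init_seg_def underS_def ord_suc_def Field_def)
  have "Field (map_prod Some Some ` r) = Some ` Field r"
    by (force simp: Field_def)
  then have "BNF_Wellorder_Embedding.iso r (init_seg (ord_suc r) None) Some"
    unfolding seg iso_iff2 by (auto simp: bij_betw_def)
  then show ?thesis
    using assms Well_order_init_seg[OF Well_order_ord_suc[OF assms]] unfolding ordIso_def by blast
qed

lemma transfinite_power_suc:
  assumes "Well_order r"
  shows "transfinite_power R I (ord_suc r) =
           (transfinite_power R I r \<cdot>\<^bsub>R\<^esub> I) <+>\<^bsub>R\<^esub> (I \<cdot>\<^bsub>R\<^esub> transfinite_power R I r)"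
proof -
  have "transfinite_power R I (init_seg (ord_suc r) None) = transfinite_power R I r"
    by (rule transfinite_power_ordIso[symmetric, OF init_seg_ord_suc[OF assms]])
  then show ?thesis
    by (simp add: transfinite_power_max[OF Well_order_ord_suc[OF assms] is_max_ord_suc] Let_def)
qed

lemma Field_omega_squared [simp]: "Field omega_squared = UNIV"
  by (auto simp: omega_squared_def Field_def)

lemma Well_order_omega_squared: "Well_order omega_squared"
proof -
  have "omega_squared - Id = less_than <*lex*> less_than"
    by (auto simp: omega_squared_def)
  then have "wf (omega_squared - Id)"
    by (simp add: wf_lex_prod)
  moreover have "Refl omega_squared" "trans omega_squared" "antisym omega_squared" "Total omega_squared"
    unfolding refl_on_def trans_def antisym_def total_on_def Field_omega_squared
    by (auto simp: omega_squared_def)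
  ultimately show ?thesis
    by (simp add: order_on_defs)
qed

text \<open>
  Every ordinal smaller than \<open>r\<close> is represented on the type of \<open>r\<close> (by an initial segment of
  \<open>r\<close>), so it suffices to quantify over that type.
\<close>

definition is_transfinite_length :: "('a, 'b) ring_scheme \<Rightarrow> 'a set \<Rightarrow> 'o rel \<Rightarrow> bool" where
  "is_transfinite_length R I r \<longleftrightarrow>
     Well_order r \<and>
     transfinite_power R I r = transfinite_power R I (ord_suc r) \<and>
     (\<forall>s :: 'o rel. s <o r \<longrightarrow> transfinite_power R I s \<noteq> transfinite_power R I (ord_suc s))"


section \<open>The algebra\<close>

datatype generator = Ga | Gb | Gc | Gd | Gx | Gy

definition P_ring :: "(generator, 'k::field) free_algebra ring" where
  "P_ring = ring_of_type_algebra"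

definition P_augmentation :: "(generator, 'k::field) free_algebra \<Rightarrow> 'k" where
  "P_augmentation = eval_free (\<lambda>_. 0)"

definition e0 :: "(generator, 'k::field) free_algebra" where
  "e0 = (1 + gen Ga) * (1 + gen Gc) - (1 + gen Gd) * (1 + gen Gy)"

definition e1 :: "(generator, 'k::field) free_algebra" where
  "e1 = (1 + gen Ga) * (1 + gen Gb) * (1 + gen Gc) - (1 + gen Gd) * (1 + gen Gx) * (1 + gen Gy)"

definition relation_ideal :: "(generator, 'k::field) free_algebra set" where
  "relation_ideal = Idl\<^bsub>P_ring\<^esub> {e0, e1}"

definition A0 :: "(generator, 'k::field) free_algebra set ring" where
  "A0 = P_ring Quot relation_ideal"

text \<open>The elements of \<^const>\<open>A0\<close> are cosets, on each of which \<^const>\<open>P_augmentation\<close> is constant.\<close>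

definition A0_augmentation :: "(generator, 'k::field) free_algebra set \<Rightarrow> 'k" where
  "A0_augmentation C = the_elem (P_augmentation ` C)"

definition A0_augmentation_ideal :: "(generator, 'k::field) free_algebra set set" where
  "A0_augmentation_ideal = a_kernel A0 (ring_of_type_algebra :: 'k ring) A0_augmentation"

lemma ring_P_ring: "ring (P_ring :: (generator, 'k::field) free_algebra ring)"
proof -
  have "\<exists>q. p + q = 0" for p :: "(generator, 'k) free_algebra"
    using add.right_inverse by blast
  then show ?thesis
    unfolding P_ring_def ring_of_type_algebra_def using add.right_inverse
    by unfold_locales (auto simp: algebra_simps Units_def)
qed

lemma P_augmentation_ring_hom:
  "ring_hom_ring (P_ring :: (generator, 'k::field) free_algebra ring)
     ring_of_type_algebra P_augmentation"
  by (rule ring_hom_ringI[OF ring_P_ring ring_from_type_algebra])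
    (simp_all add: P_ring_def ring_of_type_algebra_def P_augmentation_def eval_free_add eval_free_mult)

lemma ideal_relation_ideal:
  "ideal relation_ideal (P_ring :: (generator, 'k::field) free_algebra ring)"
  unfolding relation_ideal_def
  by (rule ring.genideal_ideal[OF ring_P_ring]) (simp add: P_ring_def ring_of_type_algebra_def)

lemma relation_ideal_subset:
  "(relation_ideal :: (generator, 'k::field) free_algebra set)
     \<subseteq> a_kernel P_ring (ring_of_type_algebra :: 'k ring) P_augmentation"
  unfolding relation_ideal_def
  by (rule ring.genideal_minimal[OF ring_P_ring ring_hom_ring.kernel_is_ideal[OF P_augmentation_ring_hom]])
    (auto simp: a_kernel_def' e0_def e1_def P_ring_def P_augmentation_def ring_of_type_algebra_def
       eval_free_diff eval_free_mult eval_free_add eval_free_gen)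

lemma A0_augmentation_coset:
  "A0_augmentation (relation_ideal +>\<^bsub>P_ring\<^esub> p) = P_augmentation (p :: (generator, 'k::field) free_algebra)"
proof -
  have "P_augmentation ` (relation_ideal +>\<^bsub>P_ring\<^esub> p) = {P_augmentation p}"
  proof (intro equalityI subsetI)
    fix y assume "y \<in> P_augmentation ` (relation_ideal +>\<^bsub>P_ring\<^esub> p)"
    then obtain i where "i \<in> relation_ideal" "y = P_augmentation (i + p)"
      by (auto simp: a_r_coset_def' P_ring_def ring_of_type_algebra_def)
    with relation_ideal_subset show "y \<in> {P_augmentation p}"
      by (auto simp: a_kernel_def' P_augmentation_def ring_of_type_algebra_def eval_free_add)
  next
    have "0 \<in> (relation_ideal :: (generator, 'k) free_algebra set)"
      using additive_subgroup.zero_closed[OF ideal.axioms(1)[OF ideal_relation_ideal]]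
      by (simp add: P_ring_def ring_of_type_algebra_def)
    then have "p \<in> relation_ideal +>\<^bsub>P_ring\<^esub> p"
      by (force simp: a_r_coset_def' P_ring_def ring_of_type_algebra_def)
    then show "y \<in> P_augmentation ` (relation_ideal +>\<^bsub>P_ring\<^esub> p)" if "y \<in> {P_augmentation p}" for y
      using that by blast
  qed
  then show ?thesis
    by (simp add: A0_augmentation_def)
qed

lemma ring_A0: "ring (A0 :: (generator, 'k::field) free_algebra set ring)"
  unfolding A0_def by (rule ideal.quotient_is_ring[OF ideal_relation_ideal])

end

theory Submission
  imports Defs "HOL-Library.Sublist"
begin

text \<open>
  Write \<open>A = 1 + a\<close>, \<open>C = 1 + c\<close>, \<open>D = 1 + d\<close>, \<open>Y = 1 + y\<close> and
  \<open>r\<^sub>n = A b\<^sup>n C - D x\<^sup>n Y\<close>.  The two relations say \<open>r\<^sub>0 = 0\<close> and \<open>r\<^sub>1 = 0\<close>.  If \<open>A\<close> and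
  \<open>Y\<close> were invertible, then \<open>u = A\<^sup>-\<^sup>1 D\<close> would satisfy \<open>C = u Y\<close> and \<open>b u = u x\<close>, and every
  \<open>r\<^sub>n\<close> would vanish.  Modulo a finite power of the augmentation ideal \<open>I\<close> both elements
  \<^emph>\<open>are\<close> invertible, so \<open>r\<^sub>2\<close> lies in all \<open>I\<^sup>n\<close>, hence in \<open>I\<^sup>\<omega>\<close>
  (\<open>second_relation_cong\<close>).  It follows that \<open>r\<^sub>2\<^sup>m a\<^sup>n\<close> lies in \<open>I\<^bsup>\<omega>m+n\<^esup>\<close>.

  For bounds in the other direction, adjoin the \<open>r\<^sub>n\<close> with \<open>n \<ge> 2\<close> as letters and read their
  definition as the rewrite rule \<open>D x\<^sup>n Y \<rightarrow> A b\<^sup>n C - r\<^sub>n\<close>, with \<open>r\<^sub>0 = r\<^sub>1 = 0\<close>.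
  Two left hand sides never overlap, so
  the algebra has a basis of words in \<open>A, b, C, D, x, Y, r\<^sub>2, r\<^sub>3, \<dots>\<close> without a factor
  \<open>D x\<^sup>n Y\<close>; the normal form map is \<open>nf\<close> (\<open>nf_eq_0_iff\<close>, \<open>nf_mult\<close>).  Rewriting never
  removes a letter \<open>r\<^sub>n\<close>, so the number of these letters is a filtration, and in the associated
  graded algebra the rule becomes \<open>D x\<^sup>n Y = A b\<^sup>n C\<close> for all \<open>n\<close>.  These relations do have a model
  in which \<open>u\<close> is invertible: put \<open>D = A U\<close>, \<open>C = U Y\<close> and \<open>x = U\<^sup>-\<^sup>1 b U\<close>, where \<open>U = 1 + u\<close>
  and \<open>u\<^sup>4 = 0\<close>.  The nilpotency makes \<open>U\<^sup>-\<^sup>1\<close> a polynomial, so that the model is graded by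
  word length and elements of the augmentation ideal have positive degree; the exponent 4 is large enough
  for the model to separate all reduced words (\<open>detect_separates\<close>), because only the powers
  \<open>U\<^sup>-\<^sup>1, 1, U, U\<^sup>2\<close> occur between two other letters.

  Hence, if \<open>filt m n\<close> is the set of elements whose normal form has at least \<open>m\<close> letters \<open>r\<^sub>i\<close> in
  every word, and whose part with exactly \<open>m\<close> of them has degree at least \<open>n\<close> in the other letters
  of the model, then multiplication by \<open>I\<close> takes \<open>filt m n\<close> to \<open>filt m (n + 1)\<close>, and
  \<open>\<Inter>n. filt m n \<subseteq> filt (m + 1) 0\<close>.  So \<open>I\<^bsup>\<omega>m+n\<^esup>\<close> is contained in \<open>filt m n\<close>.  As
  \<open>r\<^sub>2\<^sup>m a\<^sup>n\<close> is not in \<open>filt m (n + 1)\<close>, the powers decrease strictly below \<open>\<omega>\<^sup>2\<close>, and as the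
  intersection of all \<open>filt m 0\<close> is zero, \<open>I\<close> to the power \<open>\<omega>\<^sup>2\<close> is zero.
\<close>


section \<open>Linear maps and homomorphisms on free algebras\<close>

definition wmono :: "'g list \<Rightarrow> ('g, 'k::field) free_algebra" where
  "wmono w = Poly_Mapping.single (Word w) 1"

abbreviation cf :: "('g, 'k::field) free_algebra \<Rightarrow> 'g list \<Rightarrow> 'k" where
  "cf p w \<equiv> Poly_Mapping.lookup p (Word w)"

lemma wmono_Nil: "wmono [] = 1"
  by (simp add: wmono_def flip: zero_word_def)

lemma wmono_mult: "wmono u * wmono v = wmono (u @ v)"
  by (simp add: wmono_def mult_single plus_word_def)

lemma gen_mono: "gen g * wmono w = wmono (g # w)"
  by (simp add: gen_def wmono_def mult_single plus_word_def)

lemma wmono_Cons: "wmono (g # w) = gen g * wmono w"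
  by (simp add: gen_mono)

lemma wmono_replicate: "wmono (replicate n g) = gen g ^ n"
  by (induction n) (simp_all add: wmono_Nil wmono_Cons)

lemma cf_mono: "cf (wmono w) v = (if v = w then 1 else 0)"
  by (auto simp: wmono_def lookup_single when_def)

lemma cf_1: "cf 1 v = (if v = [] then 1 else 0)"
  using cf_mono[of "[]" v] by (simp add: wmono_Nil)

lemma cf_gen: "cf (gen g) z = (if z = [g] then 1 else 0)"
  using cf_mono[of "[g]" z] by (simp add: gen_def wmono_def)

lemma free_algebra_eqI: "(\<And>w. cf p w = cf q w) \<Longrightarrow> p = q"
  by (rule poly_mapping_eqI) (metis word.exhaust)

lemma single_mono: "Poly_Mapping.single (Word w) c = scalar c * wmono w"
  by (simp add: scalar_def wmono_def mult_single)

lemma linear_induct [case_names add scale wmono]: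
  fixes p :: "('g, 'k::field) free_algebra"
  assumes "\<And>p q. P p \<Longrightarrow> P q \<Longrightarrow> P (p + q)" "\<And>c p. P p \<Longrightarrow> P (scalar c * p)" "\<And>w. P (wmono w)"
  shows "P p"
proof (induction p rule: free_algebra_induct)
  case zero
  show ?case using assms(2)[OF assms(3), of 0] by (simp add: scalar_def)
next
  case (add w c p)
  then show ?case using assms by (cases w) (simp add: single_mono)
qed

lemma scalar_comm: "p * scalar c = scalar c * p"
  by (induction p rule: free_algebra_induct)
    (simp_all add: algebra_simps scalar_def mult_single)

lemma scalar_left_comm: "p * (scalar c * q) = scalar c * (p * q)"
  by (metis scalar_comm mult.assoc)

lemma cf_scalar: "cf (scalar c * p) w = c * cf p w"
proof (induction p rule: free_algebra_induct)
  case (add v d p)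
  then show ?case
    by (simp add: algebra_simps scalar_def mult_single lookup_add lookup_single when_def)
qed simp

lemma scalar_simps [simp]: "scalar 0 = 0" "scalar 1 = 1"
  by (simp_all add: scalar_def)

lemma scalar_mult: "scalar (c * d) = scalar c * scalar d"
  by (simp add: scalar_def mult_single)

lemma scalar_add: "scalar (c + d) = scalar c + scalar d"
  by (simp add: scalar_def single_add)

definition lin_ext :: "('g list \<Rightarrow> ('h, 'k::field) free_algebra) \<Rightarrow> ('g, 'k) free_algebra \<Rightarrow> ('h, 'k) free_algebra"
  where "lin_ext f p = (\<Sum>w \<in> Poly_Mapping.keys p. scalar (Poly_Mapping.lookup p w) * f (letters w))"

lemma lin_superset:
  assumes "finite S" "Poly_Mapping.keys p \<subseteq> S"
  shows "lin_ext f p = (\<Sum>w\<in>S. scalar (Poly_Mapping.lookup p w) * f (letters w))"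
  unfolding lin_ext_def
  by (rule sum.mono_neutral_left) (use assms in \<open>auto simp: in_keys_iff\<close>)

lemma lin_add: "lin_ext f (p + q) = lin_ext f p + lin_ext f q"
proof -
  let ?S = "Poly_Mapping.keys p \<union> Poly_Mapping.keys q"
  have "Poly_Mapping.keys (p + q) \<subseteq> ?S"
    by (rule Poly_Mapping.keys_add)
  then show ?thesis
    by (simp add: lin_superset[of ?S] lookup_add scalar_add sum.distrib distrib_right)
qed

lemma lin_mono: "lin_ext f (wmono w) = f w"
  by (subst lin_superset[of "{Word w}"]) (auto simp: wmono_def lookup_single)

lemma lin_0: "lin_ext f 0 = 0"
  by (simp add: lin_ext_def)

lemma lin_scale: "lin_ext f (scalar c * p) = scalar c * lin_ext f p"
proof (induction p rule: free_algebra_induct)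
  case (add w d p)
  have single: "lin_ext f (Poly_Mapping.single w err_elt) = scalar err_elt * f (letters w)" for err_elt
    by (subst lin_superset[of "{w}"]) (auto simp: lookup_single)
  have "scalar c * Poly_Mapping.single w d = Poly_Mapping.single w (c * d)"
    by (simp add: scalar_def mult_single)
  with add show ?case
    by (simp add: distrib_left lin_add single mult.assoc scalar_mult)
qed (simp add: lin_0)

lemma lin_diff: "lin_ext f (p - q) = lin_ext f p - lin_ext f q"
  using lin_add[of f "p - q" q] by simp

lemma cf_lin: "cf (lin_ext f p) z = (\<Sum>w \<in> Poly_Mapping.keys p. Poly_Mapping.lookup p w * cf (f (letters w)) z)"
  by (simp add: lin_ext_def lookup_sum cf_scalar)

definition subst :: "('g \<Rightarrow> ('h, 'k::field) free_algebra) \<Rightarrow> ('g, 'k) free_algebra \<Rightarrow> ('h, 'k) free_algebra"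
  where "subst f = lin_ext (\<lambda>w. prod_list (map f w))"

lemma subst_add: "subst f (p + q) = subst f p + subst f q"
  and subst_diff: "subst f (p - q) = subst f p - subst f q"
  and subst_scale: "subst f (scalar c * p) = scalar c * subst f p"
  and subst_mono: "subst f (wmono w) = prod_list (map f w)"
  and subst_0 [simp]: "subst f 0 = 0"
  by (simp_all add: subst_def lin_add lin_diff lin_scale lin_mono lin_0)

lemma subst_1 [simp]: "subst f 1 = 1"
  using subst_mono[of f "[]"] by (simp add: wmono_Nil)

lemma subst_gen: "subst f (gen g) = f g"
  using subst_mono[of f "[g]"] by (simp add: wmono_Cons wmono_Nil)

lemma subst_mult: "subst f (p * q) = subst f p * subst f q"
proof (induction p rule: linear_induct)
  case (wmono u)
  show ?case
    by (induction q rule: linear_induct)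
      (simp_all add: subst_add subst_scale subst_mono wmono_mult distrib_left scalar_left_comm)
qed (simp_all add: subst_add subst_scale distrib_right mult.assoc)

lemma subst_power: "subst f (p ^ n) = subst f p ^ n"
  by (induction n) (simp_all add: subst_mult)

lemma hom_ext:
  assumes "\<And>p q. h (p + q) = h p + h q" "\<And>p q. h (p * q) = h p * h q" "\<And>c. h (scalar c) = h' (scalar c)"
    "\<And>p q. h' (p + q) = h' p + h' q" "\<And>p q. h' (p * q) = h' p * h' q" "\<And>g. h (gen g) = h' (gen g)"
  shows "h p = h' p"
proof (induction p rule: linear_induct)
  case (wmono w)
  show ?case
    by (induction w) (use assms(3)[of 1] in \<open>simp_all add: assms wmono_Nil wmono_Cons\<close>)
qed (simp_all add: assms)

lemma subst_scalar: "subst f (scalar c) = scalar c"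
  using subst_scale[of f c 1] by simp

lemma cf_mult: "cf (f * g) w = (\<Sum>i\<le>length w. cf f (take i w) * cf g (drop i w))"
proof (induction f rule: linear_induct)
  case (wmono u)
  have iff: "cf (wmono u * g) w = (if take (length u) w = u then cf g (drop (length u) w) else 0)"
  proof (induction g rule: linear_induct)
    case (wmono v)
    show ?case
      by (auto simp: wmono_mult cf_mono) (metis append_take_drop_id)
  qed (simp_all add: lookup_add distrib_left scalar_left_comm cf_scalar)
  have "(\<Sum>i\<le>length w. cf (wmono u) (take i w) * cf g (drop i w))
      = (\<Sum>i\<le>length w. if i = length u then (if take (length u) w = u then cf g (drop (length u) w) else 0) else 0)"
    by (rule sum.cong) (auto simp: cf_mono)
  also have "\<dots> = (if take (length u) w = u then cf g (drop (length u) w) else 0)"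
    by auto
  finally show ?case using iff by simp
qed (simp_all add: lookup_add distrib_right sum.distrib mult.assoc cf_scalar sum_distrib_left)


section \<open>The relation ideal\<close>

abbreviation rel :: "(generator, 'k::field) free_algebra set" where
  "rel \<equiv> relation_ideal"

lemma rel_0 [simp]: "0 \<in> rel"
  using additive_subgroup.zero_closed[OF ideal.axioms(1)[OF ideal_relation_ideal]]
  by (simp add: P_ring_def ring_of_type_algebra_def)

lemma rel_add: "p \<in> rel \<Longrightarrow> q \<in> rel \<Longrightarrow> p + q \<in> rel"
  using additive_subgroup.a_closed[OF ideal.axioms(1)[OF ideal_relation_ideal], of p q]
  by (simp add: P_ring_def ring_of_type_algebra_def)

lemma rel_left: "p \<in> rel \<Longrightarrow> q * p \<in> rel"
  using ideal.I_l_closed[OF ideal_relation_ideal, of p q]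
  by (simp add: P_ring_def ring_of_type_algebra_def)

lemma rel_right: "p \<in> rel \<Longrightarrow> p * q \<in> rel"
  using ideal.I_r_closed[OF ideal_relation_ideal, of p q]
  by (simp add: P_ring_def ring_of_type_algebra_def)

lemma rel_uminus: "p \<in> rel \<Longrightarrow> - p \<in> rel"
  using rel_left[of p "- 1"] by simp

lemma rel_diff: "p \<in> rel \<Longrightarrow> q \<in> rel \<Longrightarrow> p - q \<in> rel"
  using rel_add[OF _ rel_uminus] by force

lemma e0_in_rel: "e0 \<in> rel" and e1_in_rel: "e1 \<in> rel"
  using ring.genideal_self[OF ring_P_ring, of "{e0, e1}"]
  by (auto simp: relation_ideal_def P_ring_def ring_of_type_algebra_def)

text \<open>
  The ideal generated by the two relations is characterised on the type itself, so that congruences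
  can be computed with the ring operations of the type class.
\<close>

lemma rel_minimal:
  fixes S :: "(generator, 'k::field) free_algebra set"
  assumes "0 \<in> S" "\<And>p q. p \<in> S \<Longrightarrow> q \<in> S \<Longrightarrow> p + q \<in> S"
    "\<And>p q. p \<in> S \<Longrightarrow> q * p \<in> S" "\<And>p q. p \<in> S \<Longrightarrow> p * q \<in> S" "e0 \<in> S" "e1 \<in> S"
  shows "rel \<subseteq> S"
proof -
  have neg: "- p \<in> S" if "p \<in> S" for p
    using assms(3)[OF that, of "- 1"] by simp
  have "subgroup S (add_monoid P_ring)"
  proof (rule group.subgroupI)
    show "Group.group (add_monoid (P_ring :: (generator, 'k) free_algebra ring))"
      using abelian_group.a_group[OF ring.is_abelian_group[OF ring_P_ring]] .
    fix p assume p: "p \<in> S"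
    have "- p = inv\<^bsub>add_monoid P_ring\<^esub> p"
      by (rule sym, rule group.inv_equality[OF \<open>Group.group (add_monoid P_ring)\<close>])
        (simp_all add: P_ring_def ring_of_type_algebra_def)
    then show "inv\<^bsub>add_monoid P_ring\<^esub> p \<in> S" using neg[OF p] by simp
  qed (use assms in \<open>auto simp: P_ring_def ring_of_type_algebra_def\<close>)
  then have "ideal S P_ring"
    by (rule idealI[OF ring_P_ring])
      (use assms in \<open>auto simp: P_ring_def ring_of_type_algebra_def\<close>)
  then show ?thesis
    unfolding relation_ideal_def using assms by (intro ring.genideal_minimal[OF ring_P_ring]) auto
qed


section \<open>Normal forms\<close>

text \<open>
  The letters \<open>LA, LC, LD, LY\<close> stand for one plus the corresponding generator, so that each
  relation is a difference of two words.  \<open>LE j\<close> stands for \<open>r\<^bsub>j+2\<^esub>\<close>: the elements \<open>r\<^sub>0\<close> and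
  \<open>r\<^sub>1\<close> are zero and get no letter.
\<close>

datatype letter = LA | LB | LC | LD | LX | LY | is_LE: LE nat

fun strip_xy :: "letter list \<Rightarrow> (nat \<times> letter list) option" where
  "strip_xy (LY # z) = Some (0, z)"
| "strip_xy (LX # z) = map_option (apfst Suc) (strip_xy z)"
| "strip_xy _ = None"

lemma strip_xy_Some: "strip_xy w = Some (n, z) \<longleftrightarrow> w = replicate n LX @ LY # z"
proof (induction w arbitrary: n)
  case (Cons s w)
  show ?case by (cases s; cases n) (auto simp: Cons)
qed simp

definition err_letter :: "nat \<Rightarrow> (letter, 'k::field) free_algebra" where
  "err_letter n = (case n of Suc (Suc j) \<Rightarrow> gen (LE j) | _ \<Rightarrow> 0)"

text \<open>
  Left multiplication of a word by a letter, followed by at most one rewriting step at the front.  As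
  every left hand side of a rule begins with \<open>D\<close>, and \<open>A b\<^sup>n C\<close> and \<open>r\<^sub>n\<close> contain no \<open>D\<close>, nothing
  else becomes reducible if the word was reduced.  This gives a module over the algebra, so confluence
  of the rewriting system need not be argued separately.
\<close>

fun lword :: "letter \<Rightarrow> letter list \<Rightarrow> (letter, 'k::field) free_algebra" where
  "lword LD w = (case strip_xy w of None \<Rightarrow> wmono (LD # w)
      | Some (n, z) \<Rightarrow> wmono (LA # replicate n LB @ LC # z) - err_letter n * wmono z)"
| "lword s w = wmono (s # w)"

definition lact :: "letter \<Rightarrow> (letter, 'k::field) free_algebra \<Rightarrow> (letter, 'k) free_algebra" where
  "lact s = lin_ext (lword s)"

definition wact :: "letter list \<Rightarrow> (letter, 'k::field) free_algebra \<Rightarrow> (letter, 'k) free_algebra" where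
  "wact w q = foldr lact w q"

text \<open>
  \<open>act p q\<close> lets all letters of \<open>p\<close> act on \<open>q\<close>, the letters \<open>LE j\<close> included.  On normal forms
  it is the multiplication of the algebra (see \<open>nf_mult\<close>).
\<close>

definition act :: "(letter, 'k::field) free_algebra \<Rightarrow> (letter, 'k) free_algebra \<Rightarrow> (letter, 'k) free_algebra" where
  "act p q = lin_ext (\<lambda>w. wact w q) p"

lemma lact_linear:
  "lact s (p + q) = lact s p + lact s q" "lact s (p - q) = lact s p - lact s q"
  "lact s (scalar c * p) = scalar c * lact s p" "lact s (wmono w) = lword s w" "lact s 0 = 0"
  by (simp_all add: lact_def lin_add lin_diff lin_scale lin_mono lin_0)

lemma wact_linear:
  "wact w (p + q) = wact w p + wact w q" "wact w (scalar c * p) = scalar c * wact w p" "wact w 0 = 0"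
  by (induction w) (simp_all add: wact_def lact_linear)

lemma wact_append: "wact (u @ v) q = wact u (wact v q)"
  by (simp add: wact_def)

lemma act_add_left: "act (p + p') q = act p q + act p' q"
  and act_diff_left: "act (p - p') q = act p q - act p' q"
  and act_scale_left: "act (scalar c * p) q = scalar c * act p q"
  and act_mono: "act (wmono w) q = wact w q"
  and act_0_left [simp]: "act 0 q = 0"
  by (simp_all add: act_def lin_add lin_diff lin_scale lin_mono lin_0)

lemma act_scale_right: "act p (scalar c * q) = scalar c * act p q"
  by (induction p rule: linear_induct)
    (simp_all add: act_add_left act_scale_left act_mono wact_linear distrib_left
       mult.assoc[symmetric] scalar_mult[symmetric] mult.commute)

lemma act_0_right [simp]: "act p 0 = 0"
  using act_scale_right[of p 0 0] by simp

lemma act_1: "act 1 q = q"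
  using act_mono[of "[]" q] by (simp add: wmono_Nil wact_def)

lemma act_gen: "act (gen s) q = lact s q"
  using act_mono[of "[s]" q] by (simp add: wmono_Nil wmono_Cons wact_def)

lemma act_mult: "act (p * p') q = act p (act p' q)"
proof (induction p rule: linear_induct)
  case (wmono u)
  show ?case
    by (induction p' rule: linear_induct)
      (simp_all add: act_add_left act_scale_left act_mono wact_linear wact_append distrib_left
         scalar_left_comm wmono_mult)
qed (simp_all add: act_add_left act_scale_left distrib_right mult.assoc)

lemma lact_free: "s \<noteq> LD \<Longrightarrow> lact s q = gen s * q"
proof (induction q rule: linear_induct)
  case (wmono w)
  then show ?case by (cases s) (simp_all add: lact_linear wmono_Cons)
qed (simp_all add: lact_linear distrib_left scalar_left_comm)

lemma lact_power: "s \<noteq> LD \<Longrightarrow> act (gen s ^ n) q = gen s ^ n * q"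
  by (induction n) (simp_all add: act_1 act_mult act_gen lact_free mult.assoc)

lemma lact_D_XY:
  fixes q :: "(letter, 'k::field) free_algebra"
  shows "lact LD (gen LX ^ n * (gen LY * q)) = gen LA * gen LB ^ n * gen LC * q - err_letter n * q"
proof (induction q rule: linear_induct)
  case (wmono z)
  have "strip_xy (replicate n LX @ LY # z) = Some (n, z)"
    by (simp add: strip_xy_Some)
  moreover have "gen LX ^ n * (gen LY * wmono z) = (wmono (replicate n LX @ LY # z) :: (letter, 'k) free_algebra)"
    by (simp add: gen_mono wmono_mult flip: wmono_replicate)
  ultimately show ?case
    by (simp add: lact_linear) (simp add: wmono_mult gen_mono mult.assoc flip: wmono_replicate)
qed (simp_all add: lact_linear distrib_left right_diff_distrib scalar_left_comm add_diff_add)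

subsection \<open>Comparison with the presented algebra\<close>

definition emb :: "(generator, 'k::field) free_algebra \<Rightarrow> (letter, 'k) free_algebra" where
  "emb = subst (\<lambda>g. case g of Ga \<Rightarrow> gen LA - 1 | Gb \<Rightarrow> gen LB | Gc \<Rightarrow> gen LC - 1
      | Gd \<Rightarrow> gen LD - 1 | Gx \<Rightarrow> gen LX | Gy \<Rightarrow> gen LY - 1)"

abbreviation (input) pA :: "(generator, 'k::field) free_algebra" where "pA \<equiv> 1 + gen Ga"
abbreviation (input) pC :: "(generator, 'k::field) free_algebra" where "pC \<equiv> 1 + gen Gc"
abbreviation (input) pD :: "(generator, 'k::field) free_algebra" where "pD \<equiv> 1 + gen Gd"
abbreviation (input) pY :: "(generator, 'k::field) free_algebra" where "pY \<equiv> 1 + gen Gy"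

definition err_elt :: "nat \<Rightarrow> (generator, 'k::field) free_algebra" where
  "err_elt n = pA * gen Gb ^ n * pC - pD * gen Gx ^ n * pY"

definition ev :: "(letter, 'k::field) free_algebra \<Rightarrow> (generator, 'k) free_algebra" where
  "ev = subst (\<lambda>s. case s of LA \<Rightarrow> pA | LB \<Rightarrow> gen Gb | LC \<Rightarrow> pC | LD \<Rightarrow> pD
      | LX \<Rightarrow> gen Gx | LY \<Rightarrow> pY | LE j \<Rightarrow> err_elt (Suc (Suc j)))"

lemma ev_simps:
  "ev (p + q) = ev p + ev q" "ev (p - q) = ev p - ev q" "ev (p * q) = ev p * ev q"
  "ev (scalar c) = scalar c" "ev (p ^ n) = ev p ^ n" "ev 1 = 1"
  "ev (gen LA) = pA" "ev (gen LB) = gen Gb" "ev (gen LC) = pC" "ev (gen LD) = pD"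
  "ev (gen LX) = gen Gx" "ev (gen LY) = pY" "ev (gen (LE j)) = err_elt (Suc (Suc j))"
  by (simp_all add: ev_def subst_add subst_diff subst_mult subst_gen subst_scalar subst_power)

lemmas emb_simps = subst_add subst_diff subst_mult subst_gen subst_scale subst_scalar subst_power

lemma emb_gen: "emb (gen g) = (case g of Ga \<Rightarrow> gen LA - 1 | Gb \<Rightarrow> gen LB | Gc \<Rightarrow> gen LC - 1
      | Gd \<Rightarrow> gen LD - 1 | Gx \<Rightarrow> gen LX | Gy \<Rightarrow> gen LY - 1)"
  by (simp add: emb_def subst_gen)

lemma emb_eqs:
  "emb (p + q) = emb p + emb q" "emb (p - q) = emb p - emb q" "emb (p * q) = emb p * emb q"
  "emb (scalar c) = scalar c" "emb (p ^ n) = emb p ^ n" "emb 1 = 1" "emb 0 = 0"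
  by (simp_all add: emb_def emb_simps)

lemma emb_gens:
  "emb pA = gen LA" "emb (gen Gb) = gen LB" "emb pC = gen LC" "emb pD = gen LD"
  "emb (gen Gx) = gen LX" "emb pY = gen LY"
  by (simp_all add: emb_def emb_simps)

lemma emb_err_elt: "emb (err_elt n) = gen LA * gen LB ^ n * gen LC - gen LD * gen LX ^ n * gen LY"
  by (simp add: err_elt_def emb_gens emb_eqs(2,3,5))

lemma ev_emb: "ev (emb p) = p"
  by (rule hom_ext[where h' = "\<lambda>p. p"])
    (simp_all add: ev_def emb_def emb_simps split: generator.split)

lemma err_elt_in_rel:
  assumes "n < 2"
  shows "(err_elt n :: (generator, 'k::field) free_algebra) \<in> rel"
proof -
  have "err_elt 0 = (e0 :: (generator, 'k) free_algebra)" "err_elt 1 = e1 - (e0 :: (generator, 'k) free_algebra)"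
    by (simp_all add: err_elt_def e0_def e1_def algebra_simps)
  with assms show ?thesis
    using e0_in_rel rel_diff[OF e1_in_rel e0_in_rel] by (auto simp: less_2_cases_iff)
qed

lemma ev_err_letter: "ev (err_letter n) - (err_elt n :: (generator, 'k::field) free_algebra) \<in> rel"
proof -
  consider "n < 2" | j where "n = Suc (Suc j)"
    by (metis One_nat_def Suc_1 less_Suc0 less_Suc_eq_0_disj not0_implies_Suc)
  then show ?thesis
  proof cases
    case 1
    then have "err_letter n = (0 :: (letter, 'k) free_algebra)" by (auto simp: err_letter_def less_2_cases_iff)
    with 1 show ?thesis using rel_uminus[OF err_elt_in_rel[OF 1]] by (simp add: ev_def)
  qed (simp add: err_letter_def ev_simps)
qed

text \<open>
  A rewriting step does not change the value in the presented algebra, as \<open>r\<^sub>n\<close> is by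
  definition the difference of the two words; for \<open>n < 2\<close> the defining relations are used.
\<close>

lemma ev_lact:
  fixes q :: "(letter, 'k::field) free_algebra"
  shows "ev (lact s q) - ev (gen s) * ev q \<in> rel"
proof (induction q rule: linear_induct)
  case (add p q)
  from rel_add[OF this] show ?case
    by (simp add: lact_linear ev_simps algebra_simps)
next
  case (scale c p)
  from rel_left[OF this, of "scalar c"] show ?case
    by (simp add: lact_linear ev_simps scalar_left_comm right_diff_distrib)
next
  case (wmono w)
  show ?case
  proof (cases "s = LD")
    case False
    then show ?thesis by (simp add: lact_free ev_simps)
  next
    case D: True
    show ?thesis
    proof (cases "strip_xy w")
      case None
      then show ?thesis by (simp add: D lact_linear wmono_Cons ev_simps)
    next
      case (Some nz)
      then obtain n z where w: "w = replicate n LX @ LY # z"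
        using strip_xy_Some by (cases nz) auto
      have mw: "(wmono w :: (letter, 'k) free_algebra) = gen LX ^ n * (gen LY * wmono z)"
        by (simp add: w gen_mono wmono_mult flip: wmono_replicate)
      have "ev (lact s (wmono w)) - ev (gen s) * ev (wmono w)
          = (err_elt n - ev (err_letter n :: (letter, 'k) free_algebra)) * ev (wmono z)"
        unfolding mw D lact_D_XY
        by (simp add: ev_simps err_elt_def mult.assoc left_diff_distrib)
      then show ?thesis
        using rel_right[OF rel_uminus[OF ev_err_letter], of n "ev (wmono z)"] by simp
    qed
  qed
qed

lemma ev_act: "ev (act p q) - ev p * ev q \<in> rel"
proof (induction p rule: linear_induct)
  case (add p p')
  from rel_add[OF this] show ?case
    by (simp add: act_add_left ev_simps algebra_simps)
next
  case (scale c p)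
  from rel_left[OF this, of "scalar c"] show ?case
    by (simp add: act_scale_left ev_simps algebra_simps)
next
  case (wmono w)
  show ?case
  proof (induction w)
    case Nil
    show ?case by (simp add: wmono_Nil act_1 ev_simps)
  next
    case (Cons s w)
    have "ev (act (wmono (s # w)) q) - ev (wmono (s # w)) * ev q
        = (ev (lact s (act (wmono w) q)) - ev (gen s) * ev (act (wmono w) q))
          + ev (gen s) * (ev (act (wmono w) q) - ev (wmono w) * ev q)"
      by (simp add: wmono_Cons act_mult act_gen ev_simps algebra_simps)
    then show ?case
      using rel_add[OF ev_lact rel_left[OF Cons]] by simp
  qed
qed

definition nf :: "(generator, 'k::field) free_algebra \<Rightarrow> (letter, 'k) free_algebra" where
  "nf p = act (emb p) 1"

lemma nf_add: "nf (p + q) = nf p + nf q"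
  and nf_diff: "nf (p - q) = nf p - nf q"
  by (simp_all add: nf_def emb_def subst_add subst_diff act_add_left act_diff_left)

lemma ev_nf: "ev (nf p) - p \<in> rel"
  using ev_act[of "emb p" 1] by (simp add: nf_def ev_emb ev_simps)

lemma act_emb_err_elt: "act (emb (err_elt n)) q = err_letter n * q"
  using lact_D_XY[of n q]
  by (simp add: emb_err_elt act_diff_left act_mult lact_power act_gen lact_free mult.assoc)

text \<open>
  The action of the free algebra descends to the presented algebra: the rules for \<open>n = 0\<close> and
  \<open>n = 1\<close>, which produce no error letter, are the defining relations.
\<close>

lemma act_rel:
  fixes p :: "(generator, 'k::field) free_algebra"
  assumes "p \<in> rel"
  shows "act (emb p) q = 0"
proof -
  have "rel \<subseteq> {p :: (generator, 'k) free_algebra. \<forall>q. act (emb p) q = 0}"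
  proof (rule rel_minimal)
    have err_elt: "e0 = (err_elt 0 :: (generator, 'k) free_algebra)" "e1 = err_elt 0 + (err_elt 1 :: (generator, 'k) free_algebra)"
      by (simp_all add: err_elt_def e0_def e1_def algebra_simps)
    have "act (emb (err_elt 0)) q = 0" "act (emb (err_elt 1)) q = 0" for q :: "(letter, 'k) free_algebra"
      unfolding act_emb_err_elt by (simp_all add: err_letter_def)
    then show "e0 \<in> {p :: (generator, 'k) free_algebra. \<forall>q. act (emb p) q = 0}"
      "e1 \<in> {p :: (generator, 'k) free_algebra. \<forall>q. act (emb p) q = 0}"
      by (auto simp: err_elt emb_eqs(1) act_add_left)
  qed (simp_all add: emb_eqs act_add_left act_mult)
  then show ?thesis using assms by blast
qed

lemma nf_eq_0_iff: "nf p = 0 \<longleftrightarrow> p \<in> rel"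
proof
  assume "nf p = 0"
  then show "p \<in> rel" using rel_uminus[OF ev_nf[of p]] by (simp add: ev_def)
qed (simp add: nf_def act_rel)

text \<open>
  The letter \<open>LE j\<close> acts as the element \<open>r\<^bsub>j+2\<^esub>\<close> that it stands for, by \<open>lact_D_XY\<close>.
  Together with \<open>ev_nf\<close> this makes the action of \<open>p\<close> and of its normal form agree.
\<close>

lemma act_emb_ev: "act (emb (ev p)) q = act p q"
proof (induction p arbitrary: q rule: linear_induct)
  case (wmono w)
  have gen: "act (emb (ev (gen s))) q = act (gen s) q" for s and q :: "(letter, 'a) free_algebra"
    by (cases s) (simp_all add: ev_simps emb_gens act_emb_err_elt err_letter_def act_gen lact_free)
  show ?case
  proof (induction w arbitrary: q)
    case Nil
    show ?case by (simp add: wmono_Nil ev_simps emb_eqs)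
  next
    case (Cons s w)
    then show ?case by (simp add: wmono_Cons ev_simps(3) emb_eqs act_mult gen)
  qed
qed (simp_all add: ev_simps(1,3,4) emb_eqs act_add_left act_scale_left act_mult)

lemma nf_mult: "nf (p * q) = act (nf p) (nf q)"
proof -
  have "act (emb (ev (nf p) - p)) (nf q) = 0"
    by (rule act_rel[OF ev_nf])
  then have "act (emb p) (nf q) = act (nf p) (nf q)"
    by (simp add: emb_eqs act_diff_left act_emb_ev)
  then show ?thesis
    by (simp add: nf_def emb_eqs act_mult)
qed

subsection \<open>Reduced words\<close>

fun reduced :: "letter list \<Rightarrow> bool" where
  "reduced [] = True"
| "reduced (s # w) \<longleftrightarrow> reduced w \<and> (s = LD \<longrightarrow> strip_xy w = None)"

definition supp :: "('g, 'k::field) free_algebra \<Rightarrow> 'g list set" where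
  "supp p = {w. cf p w \<noteq> 0}"

lemma keys_supp: "Poly_Mapping.keys p = Word ` supp p"
proof (rule Set.set_eqI)
  fix w show "w \<in> Poly_Mapping.keys p \<longleftrightarrow> w \<in> Word ` supp p"
    by (cases w) (auto simp: supp_def in_keys_iff)
qed

lemma finite_supp: "finite (supp p)"
  using finite_keys[of p] unfolding keys_supp by (rule finite_imageD) (simp add: inj_on_def)

lemma cf_lin_supp: "cf (lin_ext f p) z = (\<Sum>w \<in> supp p. cf p w * cf (f w) z)"
proof -
  have "inj_on Word (supp p)" by (simp add: inj_on_def)
  then show ?thesis by (simp add: cf_lin keys_supp sum.reindex)
qed

lemma lin_supp:
  assumes "\<And>w. w \<in> supp p \<Longrightarrow> supp (f w) \<subseteq> S"
  shows "supp (lin_ext f p) \<subseteq> S"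
proof
  fix z assume "z \<in> supp (lin_ext f p)"
  then have "(\<Sum>w \<in> supp p. cf p w * cf (f w) z) \<noteq> 0"
    by (simp add: supp_def cf_lin_supp)
  then obtain w where "w \<in> supp p" "cf p w * cf (f w) z \<noteq> 0"
    by (rule sum.not_neutral_contains_not_neutral)
  then show "z \<in> S" using assms[of w] by (auto simp: supp_def)
qed

lemma supp_mono: "supp (wmono w) = {w}"
  by (auto simp: supp_def cf_mono)

lemma supp_add: "supp (p + q) \<subseteq> supp p \<union> supp q"
  by (auto simp: supp_def lookup_add)

lemma supp_diff: "supp (p - q) \<subseteq> supp p \<union> supp q"
  by (auto simp: supp_def lookup_minus)

lemma supp_act:
  assumes "\<And>w. w \<in> supp p \<Longrightarrow> supp (wact w q) \<subseteq> S"
  shows "supp (act p q) \<subseteq> S"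
  unfolding act_def by (rule lin_supp[OF assms])

lemma reduced_append: "reduced (u @ v) \<Longrightarrow> reduced v"
  by (induction u) auto

lemma reduced_replicate: "reduced w \<Longrightarrow> reduced (replicate n LB @ w)"
  by (induction n) auto

lemma supp_err_letter: "supp (err_letter n * wmono z) \<subseteq> {LE (n - 2) # z}"
  by (auto simp: err_letter_def gen_mono supp_mono split: nat.split) (simp_all add: supp_def)

text \<open>
  After a rewriting step the part behind the rewritten prefix is a suffix of a reduced word, and
  neither \<open>A b\<^sup>n C\<close> nor an error letter in front of it creates a new factor \<open>D x\<^sup>n Y\<close>.
\<close>

lemma reduced_lword:
  assumes "reduced w"
  shows "supp (lword s w :: (letter, 'k::field) free_algebra) \<subseteq> Collect reduced"
proof (cases "s = LD \<and> strip_xy w \<noteq> None")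
  case True
  then obtain n z where n: "strip_xy w = Some (n, z)" by auto
  then have "w = replicate n LX @ LY # z" by (simp add: strip_xy_Some)
  then have "reduced (LY # z)" using assms reduced_append by metis
  then have "reduced (LA # replicate n LB @ LC # z)" "reduced (LE (n - 2) # z)"
    using reduced_replicate[of "LC # z" n] by simp_all
  moreover
  have "supp (wmono (LA # replicate n LB @ LC # z) - err_letter n * wmono z :: (letter, 'k) free_algebra)
      \<subseteq> {LA # replicate n LB @ LC # z} \<union> {LE (n - 2) # z}"
    by (intro subset_trans[OF supp_diff] Un_mono supp_err_letter) (simp add: supp_mono)
  then have "supp (lword s w :: (letter, 'k) free_algebra)
      \<subseteq> {LA # replicate n LB @ LC # z} \<union> {LE (n - 2) # z}"
    by (simp only: True n lword.simps option.case prod.case)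
  ultimately show ?thesis by auto
next
  case False
  then have none: "s = LD \<longrightarrow> strip_xy w = None" by blast
  then have "lword s w = (wmono (s # w) :: (letter, 'k) free_algebra)"
    by (cases s) auto
  then show ?thesis using assms none by (simp add: supp_mono)
qed

lemma reduced_lact: "supp q \<subseteq> Collect reduced \<Longrightarrow> supp (lact s q) \<subseteq> Collect reduced"
  unfolding lact_def by (rule lin_supp) (use reduced_lword in auto)

lemma reduced_nf: "supp (nf p) \<subseteq> Collect reduced"
proof -
  have "supp (wact w 1) \<subseteq> Collect reduced" for w
  proof (induction w)
    case Nil
    show ?case by (simp add: wact_def supp_mono flip: wmono_Nil)
  next
    case (Cons s w)
    then show ?case using reduced_lact by (simp add: wact_def)
  qed
  then show ?thesis unfolding nf_def by (intro supp_act)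
qed


section \<open>The graded model\<close>

datatype zletter = Za | Zb | Zy | Zu | is_Ze: Ze nat

text \<open>
  The model is the free algebra on \<open>a, b, y, u\<close> and the error letters modulo \<open>u\<^sup>4\<close>.  Instead of
  forming a quotient, coefficients are only inspected at the words without a factor \<open>u u u u\<close>, the
  good words.  Factors of good words are good, so these coefficients of a product only depend
  on the same coefficients of the two factors.
\<close>

definition good :: "zletter list \<Rightarrow> bool" where
  "good z \<longleftrightarrow> \<not> sublist (replicate 4 Zu) z"

definition errors_z :: "zletter list \<Rightarrow> nat" where
  "errors_z z = length (filter is_Ze z)"

definition weight :: "zletter list \<Rightarrow> nat" where
  "weight z = length (filter (Not \<circ> is_Ze) z)"

text \<open>
  Membership in the \<open>m\<close>-th step of the filtration of the model by the number of error letters.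
\<close>

definition vanish :: "nat \<Rightarrow> (zletter, 'k::field) free_algebra \<Rightarrow> bool" where
  "vanish m f \<longleftrightarrow> (\<forall>z. good z \<longrightarrow> errors_z z < m \<longrightarrow> cf f z = 0)"

lemma errors_z_append: "errors_z (u @ v) = errors_z u + errors_z v" and weight_append: "weight (u @ v) = weight u + weight v"
  by (simp_all add: errors_z_def weight_def)

lemma good_append: "good (u @ v) \<Longrightarrow> good u \<and> good v"
  by (meson good_def sublist_appendI sublist_append_leftI sublist_append_rightI sublist_order.order.trans)

lemma vanish_0: "vanish 0 f"
  by (simp add: vanish_def)

lemma vanish_zero: "vanish m 0"
  by (simp add: vanish_def)

lemma vanish_add: "vanish m f \<Longrightarrow> vanish m g \<Longrightarrow> vanish m (f + g)"
  and vanish_diff: "vanish m f \<Longrightarrow> vanish m g \<Longrightarrow> vanish m (f - g)"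
  by (simp_all add: vanish_def lookup_add lookup_minus)

lemma vanish_le: "vanish n f \<Longrightarrow> m \<le> n \<Longrightarrow> vanish m f"
  by (auto simp: vanish_def)

lemma vanish_mult:
  assumes "vanish m f" "vanish n g"
  shows "vanish (m + n) (f * g)"
  unfolding vanish_def
proof (intro allI impI)
  fix z assume z: "good z" "errors_z z < m + n"
  have "cf f (take i z) * cf g (drop i z) = 0" for i
  proof -
    have "good (take i z)" "good (drop i z)"
      using z(1) good_append[of "take i z" "drop i z"] by simp_all
    moreover have "errors_z (take i z) < m \<or> errors_z (drop i z) < n"
      using z(2) errors_z_append[of "take i z" "drop i z"] by simp linarith
    ultimately show ?thesis using assms by (auto simp: vanish_def)
  qed
  then show "cf (f * g) z = 0" unfolding cf_mult by (intro sum.neutral ballI)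
qed

lemma vanish_lin: "(\<And>w. w \<in> supp p \<Longrightarrow> vanish m (f w)) \<Longrightarrow> vanish m (lin_ext f p)"
  by (simp add: vanish_def cf_lin_supp)

lemma vanish_trans: "vanish m (f - g) \<Longrightarrow> vanish m (g - h) \<Longrightarrow> vanish m (f - h)"
  using vanish_add[of m "f - g" "g - h"] by simp

text \<open>
  Equality with zero in the model.
\<close>

definition kill :: "(zletter, 'k::field) free_algebra \<Rightarrow> bool" where
  "kill f \<longleftrightarrow> (\<forall>m. vanish m f)"

lemma kill_mult:
  assumes "kill f"
  shows "kill (g * f * h)"
  unfolding kill_def
proof
  fix m
  have "vanish m f" using assms by (simp add: kill_def)
  from vanish_mult[OF vanish_mult[OF vanish_0[of g] this] vanish_0[of h]]
  show "vanish m (g * f * h)" by simp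
qed

lemma kill_mult_left: "kill f \<Longrightarrow> kill (g * f)" and kill_mult_right: "kill f \<Longrightarrow> kill (f * h)"
  using kill_mult[of f g 1] kill_mult[of f 1 h] by simp_all

lemma kill_trans: "kill (f - g) \<Longrightarrow> kill (g - h) \<Longrightarrow> kill (f - h)"
  unfolding kill_def using vanish_trans by blast

lemma kill_0: "kill 0"
  by (simp add: kill_def vanish_zero)

definition U :: "(zletter, 'k::field) free_algebra" where
  "U = 1 + gen Zu"

definition U_inv :: "(zletter, 'k::field) free_algebra" where
  "U_inv = 1 - gen Zu + gen Zu ^ 2 - gen Zu ^ 3"

lemma U_U_inv: "kill (U * U_inv - 1)"
proof -
  have "U * U_inv - 1 = - (gen Zu ^ 4 :: (zletter, 'a) free_algebra)"
    by (simp add: U_def U_inv_def algebra_simps numeral_eq_Suc)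
  also have "\<dots> = - wmono (replicate 4 Zu)"
    by (simp add: wmono_replicate)
  finally show ?thesis
    by (auto simp: kill_def vanish_def cf_mono good_def)
qed

definition detect_letter :: "letter \<Rightarrow> (zletter, 'k::field) free_algebra" where
  "detect_letter s = (case s of LA \<Rightarrow> 1 + gen Za | LB \<Rightarrow> gen Zb | LC \<Rightarrow> U * (1 + gen Zy)
     | LD \<Rightarrow> (1 + gen Za) * U | LX \<Rightarrow> U_inv * gen Zb * U | LY \<Rightarrow> 1 + gen Zy | LE j \<Rightarrow> gen (Ze j))"

definition detect :: "(letter, 'k::field) free_algebra \<Rightarrow> (zletter, 'k) free_algebra" where
  "detect = subst detect_letter"

lemma detect_simps:
  "detect (p + q) = detect p + detect q" "detect (p - q) = detect p - detect q"
  "detect (p * q) = detect p * detect q" "detect (scalar c) = scalar c" "detect (p ^ n) = detect p ^ n"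
  "detect 1 = 1" "detect 0 = 0" "detect (gen s) = detect_letter s"
  by (simp_all add: detect_def subst_add subst_diff subst_mult subst_scalar subst_power subst_gen)

lemma detect_lin: "detect p = lin_ext (\<lambda>w. detect (wmono w)) p"
  by (simp add: detect_def subst_def lin_mono)

text \<open>
  The identity \<open>b\<^sup>n U = U (U\<^sup>-\<^sup>1 b U)\<^sup>n\<close> in the model; multiplied by \<open>A\<close> and \<open>Y\<close> it becomes the
  relation \<open>A b\<^sup>n C = D x\<^sup>n Y\<close>.
\<close>

lemma U_conjugate:
  "kill (gen Zb ^ n * U - U * (U_inv * gen Zb * U) ^ n :: (zletter, 'k::field) free_algebra)"
proof (induction n)
  case 0
  show ?case by (simp add: kill_0)
next
  case (Suc n)
  let ?b = "gen Zb :: (zletter, 'k) free_algebra" and ?c = "U_inv * gen Zb * U :: (zletter, 'k) free_algebra"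
  have "kill (?b * (?b ^ n * U - U * ?c ^ n))"
    by (rule kill_mult_left[OF Suc])
  moreover have "kill ((U * U_inv - 1) * (- (?b * U * ?c ^ n)))"
    by (rule kill_mult_right[OF U_U_inv])
  ultimately show ?case
    using kill_trans[of "?b ^ Suc n * U" "?b * U * ?c ^ n"]
    by (simp add: mult.assoc left_diff_distrib right_diff_distrib)
qed

lemma detect_D_XY:
  "kill (detect (gen LA * gen LB ^ n * gen LC) - detect (gen LD * gen LX ^ n * gen LY))"
  using kill_mult[OF U_conjugate, of "1 + gen Za" n "1 + gen Zy"]
  by (simp add: detect_simps detect_letter_def mult.assoc left_diff_distrib right_diff_distrib)

subsection \<open>Counting error letters\<close>

definition errors :: "letter list \<Rightarrow> nat" where
  "errors w = length (filter is_LE w)"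

definition errors_ge :: "nat \<Rightarrow> (letter, 'k::field) free_algebra \<Rightarrow> bool" where
  "errors_ge m q \<longleftrightarrow> supp q \<subseteq> {w. m \<le> errors w}"

lemma vanish_detect_letter: "vanish (errors [s]) (detect_letter s)"
proof (cases s)
  case (LE j)
  then show ?thesis
    by (auto simp: vanish_def detect_letter_def errors_def errors_z_def cf_gen)
qed (simp_all add: errors_def vanish_0)

lemma vanish_detect_mono: "vanish (errors w) (detect (wmono w))"
proof (induction w)
  case (Cons s w)
  have "errors (s # w) = errors [s] + errors w" by (simp add: errors_def)
  then show ?case using vanish_mult[OF vanish_detect_letter[of s] Cons] by (simp add: wmono_Cons detect_simps)
qed (simp add: errors_def vanish_0)

lemma vanish_detect:
  assumes "errors_ge m q"
  shows "vanish m (detect q)"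
  unfolding detect_lin[of q]
  by (rule vanish_lin) (use assms vanish_le[OF vanish_detect_mono] in \<open>auto simp: errors_ge_def\<close>)

text \<open>
  Rewriting is invisible to leading order: the two words \<open>D x\<^sup>n Y\<close> and \<open>A b\<^sup>n C\<close> have the same
  image in the model, and the remaining term has one more error letter.
\<close>

lemma lword_order:
  fixes s w
  defines "d \<equiv> detect (lword s w) - detect_letter s * detect (wmono w :: (letter, 'k::field) free_algebra)"
  shows "errors_ge (errors (s # w)) (lword s w :: (letter, 'k) free_algebra)" "vanish (Suc (errors (s # w))) d"
proof -
  have "errors_ge (errors (s # w)) (lword s w :: (letter, 'k) free_algebra) \<and> vanish (Suc (errors (s # w))) d"
  proof (cases "s = LD \<and> strip_xy w \<noteq> None")
    case True
    then obtain n z where n: "strip_xy w = Some (n, z)" and s: "s = LD" by auto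
    then have w: "w = replicate n LX @ LY # z" by (simp add: strip_xy_Some)
    have cw: "errors (s # w) = errors z"
      by (simp add: errors_def w s)
    let ?E = "err_letter n * wmono z :: (letter, 'k) free_algebra"
    have lw: "lword s w = wmono (LA # replicate n LB @ LC # z) - ?E"
      by (simp add: n s)
    have E: "errors_ge (Suc (errors z)) ?E"
      using supp_err_letter[of n z] by (auto simp: errors_ge_def errors_def)
    have "errors_ge (errors z) (wmono (LA # replicate n LB @ LC # z) :: (letter, 'k) free_algebra)"
      by (simp add: errors_ge_def supp_mono errors_def)
    then have "errors_ge (errors z) (wmono (LA # replicate n LB @ LC # z) - ?E)"
      using E supp_diff[of "wmono (LA # replicate n LB @ LC # z)" ?E] unfolding errors_ge_def by fastforce
    moreover have "vanish (Suc (errors z)) d"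
    proof -
      have "d = (detect (gen LA * gen LB ^ n * gen LC) - detect (gen LD * gen LX ^ n * gen LY)) * detect (wmono z)
          - detect ?E"
        unfolding d_def lw
        by (simp add: w s wmono_Cons wmono_replicate wmono_mult[symmetric] detect_simps mult.assoc left_diff_distrib)
      moreover have "vanish (Suc (errors z))
          ((detect (gen LA * gen LB ^ n * gen LC) - detect (gen LD * gen LX ^ n * gen LY)) * detect (wmono z))"
        using kill_mult_right[OF detect_D_XY] unfolding kill_def by blast
      ultimately show ?thesis using vanish_diff[OF _ vanish_detect[OF E]] by metis
    qed
    ultimately show ?thesis unfolding cw lw by blast
  next
    case False
    then have "lword s w = (wmono (s # w) :: (letter, 'k) free_algebra)"
      by (cases s; cases "strip_xy w") auto
    then show ?thesis
      by (simp add: d_def errors_ge_def supp_mono) (simp add: wmono_Cons detect_simps vanish_zero)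
  qed
  then show "errors_ge (errors (s # w)) (lword s w :: (letter, 'k) free_algebra)" "vanish (Suc (errors (s # w))) d"
    by blast+
qed

lemma lact_order:
  assumes "errors_ge m q"
  shows "errors_ge (errors [s] + m) (lact s q)" "vanish (Suc (errors [s] + m)) (detect (lact s q) - detect_letter s * detect q)"
proof -
  have c: "errors [s] + m \<le> errors (s # w)" if "w \<in> supp q" for w
    using assms that by (auto simp: errors_ge_def errors_def)
  show "errors_ge (errors [s] + m) (lact s q)"
    unfolding errors_ge_def lact_def
    by (rule lin_supp) (use lword_order(1) c in \<open>fastforce simp: errors_ge_def\<close>)
  have "detect (lact s q) - detect_letter s * detect q = lin_ext (\<lambda>w. detect (lword s w) - detect_letter s * detect (wmono w)) q"
    by (induction q rule: linear_induct)
      (simp_all add: lact_linear detect_simps lin_add lin_scale lin_mono algebra_simps scalar_left_comm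
        right_diff_distrib[symmetric])
  moreover have "vanish (Suc (errors [s] + m)) (detect (lword s w) - detect_letter s * detect (wmono w))"
    if "w \<in> supp q" for w
    by (rule vanish_le[OF lword_order(2)]) (use c[OF that] in simp)
  ultimately show "vanish (Suc (errors [s] + m)) (detect (lact s q) - detect_letter s * detect q)"
    by (simp only:) (rule vanish_lin)
qed

lemma wact_order:
  assumes "errors_ge m q"
  shows "errors_ge (errors w + m) (wact w q) \<and> vanish (Suc (errors w + m)) (detect (wact w q) - detect (wmono w) * detect q)"
proof (induction w)
  case Nil
  show ?case using assms by (simp add: wact_def errors_def wmono_Nil detect_simps vanish_zero)
next
  case (Cons s w)
  have cw: "errors (s # w) = errors [s] + errors w" by (simp add: errors_def)
  have "vanish (Suc (errors (s # w) + m)) (detect_letter s * (detect (wact w q) - detect (wmono w) * detect q))"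
    using vanish_mult[OF vanish_detect_letter conjunct2[OF Cons], of s] by (simp add: cw ac_simps)
  moreover have "vanish (Suc (errors (s # w) + m)) (detect (wact (s # w) q) - detect_letter s * detect (wact w q))"
    using lact_order(2)[OF conjunct1[OF Cons], of s] by (simp add: cw wact_def ac_simps)
  ultimately have "vanish (Suc (errors (s # w) + m)) (detect (wact (s # w) q) - detect (wmono (s # w)) * detect q)"
    using vanish_trans[of _ "detect (wact (s # w) q)" "detect_letter s * detect (wact w q)"]
    by (simp add: wmono_Cons detect_simps mult.assoc right_diff_distrib)
  then show ?case
    using lact_order(1)[OF conjunct1[OF Cons], of s] by (simp add: cw wact_def ac_simps)
qed

text \<open>
  To leading order in the number of error letters, multiplication of normal forms is multiplication
  in the model.  The homomorphism \<open>detect\<close> knows nothing of the rewriting in \<open>act\<close>, and each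
  rewriting step contributes an error term.
\<close>

lemma act_order:
  assumes "errors_ge m p" "errors_ge n q"
  shows "errors_ge (m + n) (act p q)" "vanish (Suc (m + n)) (detect (act p q) - detect p * detect q)"
proof -
  have c: "m \<le> errors w" if "w \<in> supp p" for w
    using assms that by (auto simp: errors_ge_def)
  show "errors_ge (m + n) (act p q)"
    unfolding errors_ge_def
    by (rule supp_act) (use wact_order[OF assms(2)] c in \<open>fastforce simp: errors_ge_def\<close>)
  have "detect (act p q) - detect p * detect q = lin_ext (\<lambda>w. detect (wact w q) - detect (wmono w) * detect q) p"
    by (induction p rule: linear_induct)
      (simp_all add: act_add_left act_scale_left act_mono detect_simps lin_add lin_scale lin_mono
        algebra_simps right_diff_distrib[symmetric])
  moreover have "vanish (Suc (m + n)) (detect (wact w q) - detect (wmono w) * detect q)" if "w \<in> supp p" for w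
    using vanish_le[OF conjunct2[OF wact_order[OF assms(2), of w]], of "Suc (m + n)"] c[OF that] by simp
  ultimately show "vanish (Suc (m + n)) (detect (act p q) - detect p * detect q)"
    by (simp add: vanish_lin)
qed


section \<open>Leading words\<close>

definition lead :: "(zletter, 'k::field) free_algebra \<Rightarrow> zletter list \<Rightarrow> bool" where
  "lead f t \<longleftrightarrow> cf f t \<noteq> 0 \<and> (\<forall>z. cf f z \<noteq> 0 \<longrightarrow> length z < length t \<or> z = t)"

text \<open>
  Lengths add up, so a word of maximal length in a product arises from one pair of factors only.
\<close>

lemma lead_mult:
  assumes "lead f t" "lead g s"
  shows "lead (f * g) (t @ s)"
proof -
  have zero: "cf f (take i z) * cf g (drop i z) = 0"
    if "length (t @ s) \<le> length z" "\<not> (z = t @ s \<and> i = length t)" "i \<le> length z" for i z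
  proof (rule ccontr)
    assume "\<not> ?thesis"
    then have *: "length (take i z) < length t \<or> take i z = t" "length (drop i z) < length s \<or> drop i z = s"
      using assms by (auto simp: lead_def)
    with that(1,3) have "take i z = t" "drop i z = s"
      by auto
    then show False using that by (metis append_take_drop_id length_take min.absorb2)
  qed
  have "cf (f * g) (t @ s) = (\<Sum>i\<le>length (t @ s). if i = length t then cf f t * cf g s else 0)"
    unfolding cf_mult by (rule sum.cong) (use zero[of "t @ s"] in auto)
  also have "\<dots> = cf f t * cf g s" by simp
  finally have "cf (f * g) (t @ s) \<noteq> 0" using assms by (simp add: lead_def)
  moreover have "length z < length (t @ s) \<or> z = t @ s" if "cf (f * g) z \<noteq> 0" for z
    using that zero[of z] unfolding cf_mult by (metis (no_types, lifting) atMost_iff leI sum.neutral)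
  ultimately show ?thesis by (simp add: lead_def)
qed

lemma lead_gen: "lead (gen g) [g]" and lead_1_gen: "lead (1 + gen g) [g]" and lead_1: "lead 1 []"
  by (auto simp: lead_def cf_gen cf_1 lookup_add split: if_splits)

lemma lead_U_inv: "lead (U_inv :: (zletter, 'k::field) free_algebra) (replicate 3 Zu)"
proof -
  have U_inv: "U_inv = (1 - wmono [Zu] + wmono [Zu, Zu] - wmono [Zu, Zu, Zu] :: (zletter, 'k) free_algebra)"
    by (simp add: U_inv_def wmono_Cons wmono_Nil numeral_eq_Suc)
  show ?thesis
    unfolding U_inv by (auto simp: lead_def lookup_add lookup_minus cf_mono cf_1 numeral_eq_Suc split: if_splits)
qed

text \<open>
  The power of \<open>U\<close> whose longest word is \<open>u\<^sup>j\<close>.  Since \<open>U\<^sup>-\<^sup>1 = 1 - u + u\<^sup>2 - u\<^sup>3\<close> in the model, the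
  exponents \<open>0, 1, 2, -1\<close> correspond to \<open>j = 0, 1, 2, 3\<close>, and \<open>j\<close> determines the exponent.
\<close>

definition gap :: "nat \<Rightarrow> (zletter, 'k::field) free_algebra" where
  "gap j = (if j = 3 then U_inv else U ^ j)"

lemma lead_U_power: "lead (U ^ j) (replicate j Zu)"
proof (induction j)
  case (Suc j)
  then show ?case using lead_mult[OF lead_1_gen[of Zu] Suc] by (simp add: U_def)
qed (simp add: lead_1)

lemma lead_gap: "lead (gap j) (replicate j Zu)"
  by (simp add: gap_def lead_U_inv lead_U_power)

text \<open>
  The image of a word in the model is written as a product of the images of \<open>A, b, Y\<close> and of error
  letters, separated by powers of \<open>U\<close>.  The letters \<open>D = A U\<close> and \<open>x = U\<^sup>-\<^sup>1 b U\<close> end in a factor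
  \<open>U\<close>, which is carried over to the next gap: \<open>c\<close> says whether such a factor comes from the left.  The
  letters \<open>C = U Y\<close> and \<open>x\<close> begin with \<open>U\<close> and \<open>U\<^sup>-\<^sup>1\<close>, so that the exponents in the gaps range
  from \<open>-1\<close> (before \<open>x\<close>) to \<open>2\<close> (in \<open>D C\<close>).
\<close>

definition gapdeg :: "bool \<Rightarrow> letter \<Rightarrow> nat" where
  "gapdeg c s = (case s of LC \<Rightarrow> if c then 2 else 1 | LX \<Rightarrow> if c then 0 else 3 | _ \<Rightarrow> of_bool c)"

definition carry :: "letter \<Rightarrow> bool" where
  "carry s \<longleftrightarrow> s = LD \<or> s = LX"

definition core :: "letter \<Rightarrow> zletter" where
  "core s = (case s of LA \<Rightarrow> Za | LD \<Rightarrow> Za | LB \<Rightarrow> Zb | LX \<Rightarrow> Zb | LC \<Rightarrow> Zy | LY \<Rightarrow> Zy | LE j \<Rightarrow> Ze j)"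

definition core_elt :: "letter \<Rightarrow> (zletter, 'k::field) free_algebra" where
  "core_elt s = (case core s of Za \<Rightarrow> 1 + gen Za | Zy \<Rightarrow> 1 + gen Zy | g \<Rightarrow> gen g)"

fun topw :: "bool \<Rightarrow> letter list \<Rightarrow> zletter list" where
  "topw c [] = replicate (of_bool c) Zu"
| "topw c (s # w) = replicate (gapdeg c s) Zu @ core s # topw (carry s) w"

fun expand :: "bool \<Rightarrow> letter list \<Rightarrow> (zletter, 'k::field) free_algebra" where
  "expand c [] = gap (of_bool c)"
| "expand c (s # w) = gap (gapdeg c s) * core_elt s * expand (carry s) w"

lemma lead_expand: "lead (expand c w) (topw c w)"
proof (induction w arbitrary: c)
  case (Cons s w)
  have "lead (core_elt s) [core s]"
    by (cases s) (simp_all add: core_elt_def core_def lead_gen lead_1_gen)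
  from lead_mult[OF lead_mult[OF lead_gap this] Cons] show ?case by simp
qed (simp add: lead_gap)

lemma expand_step:
  "kill (gap (of_bool c) * detect_letter s - gap (gapdeg c s) * core_elt s * gap (of_bool (carry s)) :: (zletter, 'k::field) free_algebra)"
proof (cases "s = LX \<and> c")
  case True
  have "kill ((U * U_inv - 1) * (gen Zb * U) :: (zletter, 'k) free_algebra)" by (rule kill_mult_right[OF U_U_inv])
  with True show ?thesis
    by (simp add: gap_def detect_letter_def gapdeg_def core_elt_def core_def carry_def mult.assoc left_diff_distrib)
next
  case False
  then have "gap (of_bool c) * detect_letter s = (gap (gapdeg c s) * core_elt s * gap (of_bool (carry s)) :: (zletter, 'k) free_algebra)"
    by (cases s; cases c)
      (simp_all add: gap_def detect_letter_def gapdeg_def core_elt_def core_def carry_def mult.assoc numeral_2_eq_2)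
  then show ?thesis by (simp only: diff_self kill_0)
qed

text \<open>
  The only cancellation needed is \<open>U U\<^sup>-\<^sup>1 = 1\<close>, in front of a letter \<open>x\<close> that follows \<open>D\<close> or \<open>x\<close>.
\<close>

lemma expand_detect:
  "kill (gap (of_bool c) * detect (wmono w) - expand c w :: (zletter, 'k::field) free_algebra)"
proof (induction w arbitrary: c)
  case Nil
  show ?case by (simp add: wmono_Nil detect_simps kill_0)
next
  case (Cons s w)
  have "kill ((gap (of_bool c) * detect_letter s - gap (gapdeg c s) * core_elt s * gap (of_bool (carry s)))
      * detect (wmono w) :: (zletter, 'k) free_algebra)"
    by (rule kill_mult_right[OF expand_step])
  moreover have "kill (gap (gapdeg c s) * core_elt s * (gap (of_bool (carry s)) * detect (wmono w) - expand (carry s) w)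
      :: (zletter, 'k) free_algebra)"
    by (rule kill_mult_left[OF Cons])
  ultimately show ?case
    using kill_trans[of "gap (of_bool c) * detect (wmono (s # w)) :: (zletter, 'k) free_algebra"
        "gap (gapdeg c s) * core_elt s * gap (of_bool (carry s)) * detect (wmono w)" "expand c (s # w)"]
    by (simp add: wmono_Cons detect_simps mult.assoc left_diff_distrib right_diff_distrib)
qed

lemma core_not_u: "core s \<noteq> Zu"
  by (cases s) (simp_all add: core_def)

lemma good_topw: "good (topw c w)"
proof (induction w arbitrary: c)
  case Nil
  show ?case by (cases c) (auto simp: good_def numeral_eq_Suc dest: sublist_length_le)
next
  case (Cons s w)
  have "gapdeg c s \<in> {0, 1, 2, 3}" by (cases s; cases c) (simp_all add: gapdeg_def)
  then show ?case
    using Cons[of "carry s"] core_not_u[of s] by (auto simp: good_def numeral_eq_Suc sublist_Cons_right)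
qed

lemma errors_z_topw: "errors_z (topw c w) = errors w"
proof (induction w arbitrary: c)
  case (Cons s w)
  have "is_Ze (core s) \<longleftrightarrow> is_LE s" by (cases s) (simp_all add: core_def)
  with Cons show ?case by (simp add: errors_z_append) (simp add: errors_z_def errors_def)
qed (simp add: errors_z_def errors_def)

lemma replicate_Cons_eq:
  assumes "x \<noteq> u" "y \<noteq> u"
  shows "replicate i u @ x # s = replicate j u @ y # t \<longleftrightarrow> i = j \<and> x = y \<and> s = t"
proof (induction i arbitrary: j)
  case 0
  then show ?case using assms by (cases j) auto
next
  case (Suc i)
  then show ?case using assms by (cases j) auto
qed

lemma topw_Nil_Cons: "topw c [] \<noteq> topw c' (s # w)"
proof
  assume "topw c [] = topw c' (s # w)"
  then have "core s \<in> set (replicate (of_bool c) Zu)" by (metis in_set_conv_decomp topw.simps)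
  then show False using core_not_u[of s] by (simp split: if_splits)
qed

text \<open>
  The first letters of \<open>w\<close> and \<open>w'\<close> can only be \<open>b\<close> and \<open>x\<close>, with no \<open>U\<close> before them and one
  carried behind, in which case the argument repeats, or \<open>C = U Y\<close> and \<open>Y\<close>.  Thus \<open>w'\<close> begins with
  some \<open>x\<^sup>n Y\<close>.
\<close>

lemma topw_carry: "topw False w = topw True w' \<Longrightarrow> strip_xy w' \<noteq> None"
proof (induction w arbitrary: w')
  case Nil
  then show ?case by (cases w') (use topw_Nil_Cons in auto)
next
  case (Cons s w)
  show ?case
  proof (cases w')
    case Nil
    then show ?thesis using Cons(2) topw_Nil_Cons[of True False s w] by simp
  next
    case w': (Cons s' v)
    then have "gapdeg False s = gapdeg True s'" "core s = core s'" "topw (carry s) w = topw (carry s') v"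
      using Cons(2) by (simp_all add: replicate_Cons_eq core_not_u)
    then show ?thesis
      using Cons(1)[of v] w' by (cases s; cases s') (auto simp: gapdeg_def core_def carry_def)
  qed
qed

text \<open>
  The gap and the letter at the front determine the first letter of the word, except that \<open>A\<close> and
  \<open>D\<close> only differ in what they carry over; by \<open>topw_carry\<close> the two could only be confused if the
  word with \<open>D\<close> were reducible.
\<close>

lemma topw_inj: "reduced w \<Longrightarrow> reduced w' \<Longrightarrow> topw c w = topw c w' \<Longrightarrow> w = w'"
proof (induction w arbitrary: c w')
  case Nil
  then show ?case by (cases w') (use topw_Nil_Cons in auto)
next
  case (Cons s w)
  show ?case
  proof (cases w')
    case Nil
    then show ?thesis using Cons(4) topw_Nil_Cons[of c c s w] by simp
  next
    case w': (Cons s' v)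
    then have eq: "gapdeg c s = gapdeg c s'" "core s = core s'" "topw (carry s) w = topw (carry s') v"
      using Cons(4) by (simp_all add: replicate_Cons_eq core_not_u)
    have *: "topw False w \<noteq> topw True v" if "s' = LD"
      using topw_carry Cons(3) w' that by force
    have **: "topw False v \<noteq> topw True w" if "s = LD"
      using topw_carry Cons(2) that by force
    have "s = s'"
      using eq * ** by (cases s; cases s'; cases c) (auto simp: gapdeg_def core_def carry_def)
    then show ?thesis using Cons(1)[of v "carry s"] Cons(2,3) eq w' by simp
  qed
qed

text \<open>
  Among the reduced words of \<open>q\<close> with exactly \<open>m\<close> error letters choose one whose leading word is
  longest.  Leading words of different reduced words differ, so no other term cancels it.
\<close>

lemma detect_separates:
  fixes q :: "(letter, 'k::field) free_algebra"
  assumes "supp q \<subseteq> Collect reduced" "errors_ge m q" "\<And>z. good z \<Longrightarrow> errors_z z = m \<Longrightarrow> cf (detect q) z = 0"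
  shows "errors_ge (Suc m) q"
proof (rule ccontr)
  assume neg: "\<not> errors_ge (Suc m) q"
  define S where "S = {w \<in> supp q. errors w = m}"
  have "S \<noteq> {}"
    using neg assms(2) by (fastforce simp: errors_ge_def S_def)
  moreover have "finite S" using finite_supp[of q] by (simp add: S_def)
  ultimately obtain w where w: "w \<in> S" and
    max: "\<And>v. v \<in> S \<Longrightarrow> length (topw False v) \<le> length (topw False w)"
    using obtains_MAX[of S "\<lambda>w. length (topw False w)"] by (metis Max_ge finite_imageI imageI)
  define t where "t = topw False w"
  have t: "good t" "errors_z t = m" using w by (simp_all add: t_def good_topw errors_z_topw S_def)
  have exp: "cf (detect (wmono v)) t = (cf (expand False v) t :: 'k)" for v
  proof -
    have "vanish (Suc m) (detect (wmono v) - expand False v :: (zletter, 'k) free_algebra)"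
      using expand_detect[of False v, where 'k = 'k] by (simp add: gap_def kill_def)
    then show ?thesis using t by (simp add: vanish_def lookup_minus)
  qed
  have other: "cf q v * cf (detect (wmono v)) t = (if v = w then cf q w * cf (detect (wmono w)) t else 0)"
    if v: "v \<in> supp q" for v
  proof (cases "v = w \<or> cf (detect (wmono v)) t = (0 :: 'k)")
    case False
    then have "errors v \<le> m"
      using vanish_detect_mono[of v] t by (fastforce simp: vanish_def not_less[symmetric])
    then have "v \<in> S" using v assms(2) by (auto simp: S_def errors_ge_def)
    then have "length (topw False v) \<le> length t" using max by (simp add: t_def)
    moreover have "cf (expand False v) t \<noteq> (0 :: 'k)" using False exp[of v] by simp
    ultimately have "topw False v = t"
      using lead_expand[of False v, where 'a = 'k] unfolding lead_def by (metis not_le)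
    then have "v = w"
      using topw_inj[of v w False] assms(1) v w by (auto simp: t_def S_def)
    with False show ?thesis by blast
  qed auto
  have "cf (detect q) t = (\<Sum>v \<in> supp q. if v = w then cf q w * cf (detect (wmono w)) t else 0)"
    unfolding detect_lin[of q] cf_lin_supp by (rule sum.cong) (use other in auto)
  also have "\<dots> = cf q w * cf (detect (wmono w)) t"
    using w finite_supp[of q] by (simp add: S_def)
  also have "\<dots> \<noteq> 0"
    using w lead_expand[of False w, where 'a = 'k] exp[of w] by (simp add: S_def supp_def lead_def t_def)
  finally show False using assms(3) t by simp
qed


section \<open>The filtration\<close>

text \<open>
  The filtration index is the ordinal \<open>\<omega> m + n\<close>: elements are compared first by the number of
  error letters, then by the degree of the part that has exactly \<open>m\<close> of them.
\<close>

definition filt :: "nat \<Rightarrow> nat \<Rightarrow> (generator, 'k::field) free_algebra set" where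
  "filt m n = {p. errors_ge m (nf p) \<and>
     (\<forall>z. good z \<longrightarrow> errors_z z = m \<longrightarrow> weight z < n \<longrightarrow> cf (detect (nf p)) z = 0)}"

lemma errors_ge_add: "errors_ge m p \<Longrightarrow> errors_ge m q \<Longrightarrow> errors_ge m (p + q)"
  using supp_add[of p q] by (auto simp: errors_ge_def)

lemma errors_ge_0: "errors_ge 0 p"
  by (simp add: errors_ge_def)

lemma filt_0_0: "filt 0 0 = UNIV"
  by (simp add: filt_def errors_ge_0)

lemma filt_add: "p \<in> filt m n \<Longrightarrow> q \<in> filt m n \<Longrightarrow> p + q \<in> filt m n"
  by (simp add: filt_def nf_add errors_ge_add detect_simps lookup_add)

lemma filt_rel: "p - q \<in> rel \<Longrightarrow> p \<in> filt m n \<longleftrightarrow> q \<in> filt m n"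
proof -
  assume "p - q \<in> rel"
  then have "nf p = nf q" using nf_eq_0_iff[of "p - q"] by (simp add: nf_diff)
  then show ?thesis by (simp add: filt_def)
qed

text \<open>
  Every word has finite weight, so for an element of all \<open>filt m n\<close> all coefficients of the part with
  \<open>m\<close> error letters vanish in the model.  The model separates reduced words, so this part is zero.
\<close>

lemma filt_Inter: "(\<Inter>n. filt m n) \<subseteq> filt (Suc m) 0"
proof
  fix p assume "p \<in> (\<Inter>n. filt m n)"
  then have "\<And>n. p \<in> filt m n" by blast
  then have "errors_ge (Suc m) (nf p)"
    by (intro detect_separates[OF reduced_nf]) (auto simp: filt_def)
  then show "p \<in> filt (Suc m) 0" by (simp add: filt_def)
qed

lemma filt_Inter_all: "(\<Inter>m. filt m 0) \<subseteq> rel"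
proof
  fix p assume "p \<in> (\<Inter>m. filt m 0)"
  then have "errors_ge m (nf p)" for m by (auto simp: filt_def)
  then have "supp (nf p) \<subseteq> {w. Suc (errors v) \<le> errors w}" for v
    unfolding errors_ge_def by blast
  from this[of w for w] have "w \<notin> supp (nf p)" for w
    using not_less_eq_eq[of "errors w" "errors w"] by blast
  then have "nf p = 0" by (intro free_algebra_eqI) (auto simp: supp_def)
  then show "p \<in> rel" by (simp add: nf_eq_0_iff)
qed

text \<open>
  Elements of the augmentation ideal have no constant term in the model, hence positive degree.
\<close>

lemma cf_detect_nf_Nil: "cf (detect (nf p)) [] = P_augmentation p"
proof -
  have Nil: "cf f [] = eval_free (\<lambda>_. 0) f" for f :: "(zletter, 'a) free_algebra"
  proof (induction f rule: linear_induct)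
    case (wmono w)
    show ?case by (cases w) (simp_all add: cf_mono, simp_all add: wmono_def eval_free_single)
  qed (simp_all add: lookup_add eval_free_add cf_scalar eval_free_mult eval_free_scalar)
  have "vanish 1 (detect (act (emb p) 1) - detect (emb p) * detect 1)"
    using act_order(2)[OF errors_ge_0 errors_ge_0, of "emb p" 1] by simp
  then have "cf (detect (nf p)) [] = cf (detect (emb p)) []"
    by (simp add: vanish_def nf_def detect_simps lookup_minus good_def errors_z_def)
  also have "\<dots> = eval_free (\<lambda>_. 0) (detect (emb p))" by (rule Nil)
  also have "\<dots> = eval_free (\<lambda>_. 0) p"
    by (rule hom_ext)
      (simp_all add: detect_simps emb_eqs eval_free_add eval_free_mult eval_free_scalar eval_free_gen
        emb_gen detect_letter_def U_def U_inv_def eval_free_diff power2_eq_square power3_eq_cube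
        split: generator.split)
  finally show ?thesis by (simp add: P_augmentation_def)
qed

lemma cf_nf_mult:
  assumes "errors_ge m (nf p)" "errors_ge n (nf q)" "good z" "errors_z z = m + n"
  shows "cf (detect (nf (p * q))) z = (\<Sum>i\<le>length z. cf (detect (nf p)) (take i z) * cf (detect (nf q)) (drop i z))"
  using act_order(2)[OF assms(1,2)] assms(3,4)
  by (simp add: vanish_def nf_mult lookup_minus flip: cf_mult)

lemma weight_pos: "errors_z z = 0 \<Longrightarrow> z \<noteq> [] \<Longrightarrow> 0 < weight z"
  by (cases z) (auto simp: errors_z_def weight_def split: if_splits)

text \<open>
  In a word with \<open>m\<close> error letters in all, those contributed by \<open>p\<close> number at least \<open>m\<close>.  Hence the
  factor from \<open>q\<close> has none and is nonempty, so it contributes at least one to the degree.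
\<close>

lemma filt_mult_augmentation:
  assumes p: "p \<in> filt m n" and q: "P_augmentation q = 0"
  shows "p * q \<in> filt m (Suc n)" "q * p \<in> filt m (Suc n)"
proof -
  have R: "errors_ge m (nf p)" using p by (simp add: filt_def)
  have vp: "cf (detect (nf p)) z = 0" if "good z" "errors_z z < m \<or> errors_z z = m \<and> weight z < n" for z
    using that vanish_detect[OF R] p by (auto simp: vanish_def filt_def)
  have vq: "cf (detect (nf q)) [] = 0" by (simp add: cf_detect_nf_Nil q)
  have prod: "cf (detect (nf p)) u * cf (detect (nf q)) v = 0"
    if "good u" "errors_z u + errors_z v = m" "weight u + weight v < Suc n" for u v
  proof (cases "v = []")
    case False
    then have "errors_z u < m \<or> errors_z u = m \<and> weight u < n"
      using that weight_pos[of v] by (cases "errors_z v = 0") auto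
    then show ?thesis using vp[OF that(1)] by simp
  qed (simp add: vq)
  show "p * q \<in> filt m (Suc n)"
    unfolding filt_def
  proof (intro CollectI conjI allI impI)
    show "errors_ge m (nf (p * q))" using act_order(1)[OF R errors_ge_0] by (simp add: nf_mult)
    fix z assume z: "good z" "errors_z z = m" "weight z < Suc n"
    have "cf (detect (nf p)) (take i z) * cf (detect (nf q)) (drop i z) = 0" for i
      using z good_append[of "take i z" "drop i z"] errors_z_append[of "take i z" "drop i z"]
        weight_append[of "take i z" "drop i z"] by (intro prod) auto
    then show "cf (detect (nf (p * q))) z = 0"
      using cf_nf_mult[OF R errors_ge_0 z(1), of q] z(2) by (simp only: add_0_right sum.neutral_const)
  qed
  show "q * p \<in> filt m (Suc n)"
    unfolding filt_def
  proof (intro CollectI conjI allI impI)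
    show "errors_ge m (nf (q * p))" using act_order(1)[OF errors_ge_0 R] by (simp add: nf_mult)
    fix z assume z: "good z" "errors_z z = m" "weight z < Suc n"
    have "cf (detect (nf p)) (drop i z) * cf (detect (nf q)) (take i z) = 0" for i
      using z good_append[of "take i z" "drop i z"] errors_z_append[of "take i z" "drop i z"]
        weight_append[of "take i z" "drop i z"] by (intro prod) auto
    then have "cf (detect (nf q)) (take i z) * cf (detect (nf p)) (drop i z) = 0" for i
      by (subst mult.commute)
    then show "cf (detect (nf (q * p))) z = 0"
      using cf_nf_mult[OF errors_ge_0 R z(1), of q] z(2) by (simp only: add_0_left sum.neutral_const)
  qed
qed

text \<open>
  In the model the element becomes the single word of \<open>m\<close> error letters followed by \<open>n\<close>
  letters \<open>a\<close>.
\<close>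

lemma witness_not_filt: "err_elt 2 ^ m * gen Ga ^ n \<notin> (filt m (Suc n) :: (generator, 'k::field) free_algebra set)"
proof -
  have nf_mult_emb: "nf (p * q) = act (emb p) (nf q)" for p q :: "(generator, 'k) free_algebra"
    by (simp add: nf_def emb_eqs act_mult)
  have a: "nf (gen Ga ^ n) = ((gen LA - 1) ^ n :: (letter, 'k) free_algebra)"
  proof (induction n)
    case (Suc n)
    then show ?case
      by (simp add: nf_mult_emb emb_def subst_gen act_diff_left act_gen lact_free act_1 left_diff_distrib)
  qed (simp add: nf_def emb_eqs act_1)
  have "nf (err_elt 2 ^ m * gen Ga ^ n) = (gen (LE 0) ^ m * (gen LA - 1) ^ n :: (letter, 'k) free_algebra)"
    by (induction m) (simp_all add: a mult.assoc nf_mult_emb act_emb_err_elt, simp add: err_letter_def numeral_2_eq_2)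
  then have "detect (nf (err_elt 2 ^ m * gen Ga ^ n)) = (wmono (replicate m (Ze 0) @ replicate n Za) :: (zletter, 'k) free_algebra)"
    by (simp add: detect_simps detect_letter_def wmono_replicate flip: wmono_mult)
  moreover have "good (replicate m (Ze 0) @ replicate n Za)"
    unfolding good_def by (auto dest!: set_mono_sublist simp: numeral_eq_Suc)
  ultimately show ?thesis
    unfolding filt_def
    by (auto simp: cf_mono errors_z_def weight_def intro!: exI[of _ "replicate m (Ze 0) @ replicate n Za"])
qed


section \<open>Transfinite powers below omega squared\<close>

text \<open>
  The power with exponent \<open>\<omega> m + n\<close>.
\<close>

definition tpow :: "('a, 'b) ring_scheme \<Rightarrow> 'a set \<Rightarrow> nat \<Rightarrow> nat \<Rightarrow> 'a set" where
  "tpow R I m n = transfinite_power R I (init_seg omega_squared (m, n))"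

lemma init_seg_init_seg:
  assumes "Well_order r" "y \<in> underS r x"
  shows "init_seg (init_seg r x) y = init_seg r y"
proof -
  have "trans r" "antisym r" using assms(1) by (simp_all add: order_on_defs)
  then have "underS r y \<subseteq> underS r x"
    using assms(2) by (auto simp: underS_def dest: transD antisymD)
  then have "underS (init_seg r x) y = underS r y"
    using assms(2) by (auto simp: init_seg_def underS_def)
  with \<open>underS r y \<subseteq> underS r x\<close> show ?thesis
    unfolding init_seg_def[of "init_seg r x"] by (auto simp: init_seg_def)
qed

lemma underS_omega_squared: "underS omega_squared (m, n) = {(i, j). i < m \<or> i = m \<and> j < n}"
  by (auto simp: underS_def omega_squared_def)

lemma Field_seg: "Field (init_seg omega_squared (m, n)) = {(i, j). i < m \<or> i = m \<and> j < n}"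
  by (simp add: Field_init_seg[OF Well_order_omega_squared] underS_omega_squared)

lemma tpow_seg: "i < m \<or> i = m \<and> j < n \<Longrightarrow>
    transfinite_power R I (init_seg (init_seg omega_squared (m, n)) (i, j)) = tpow R I i j"
  by (simp add: tpow_def init_seg_init_seg[OF Well_order_omega_squared] underS_omega_squared)

lemma tpow_0_0: "tpow R I 0 0 = carrier R"
  unfolding tpow_def
  by (rule transfinite_power_zero[OF Well_order_init_seg[OF Well_order_omega_squared]]) (simp add: Field_seg)

lemma tpow_Suc: "tpow R I m (Suc n) = (tpow R I m n \<cdot>\<^bsub>R\<^esub> I) <+>\<^bsub>R\<^esub> (I \<cdot>\<^bsub>R\<^esub> tpow R I m n)"
proof -
  have "is_max (init_seg omega_squared (m, Suc n)) (m, n)"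
    unfolding is_max_def Field_seg
    by (auto simp: init_seg_def underS_omega_squared) (auto simp: omega_squared_def)
  from transfinite_power_max[OF Well_order_init_seg[OF Well_order_omega_squared] this]
  show ?thesis by (simp add: tpow_seg Let_def) (simp add: tpow_def)
qed

lemma tpow_limit: "tpow R I (Suc m) 0 = (\<Inter>i\<in>{..m}. \<Inter>j. tpow R I i j)"
proof -
  let ?r = "init_seg omega_squared (Suc m, 0)"
  have "\<not> is_max ?r x" for x
  proof
    assume x: "is_max ?r x"
    obtain i j where ij: "x = (i, j)" by (cases x)
    \<comment> \<open>The exponent is a limit: any index has a successor below it.\<close>
    then have "(i, Suc j) \<in> Field ?r" using x by (auto simp: is_max_def Field_seg)
    then have "((i, Suc j), (i, j)) \<in> ?r" using x ij by (auto simp: is_max_def)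
    then show False by (auto simp: init_seg_def omega_squared_def)
  qed
  moreover have "(0, 0) \<in> Field ?r" by (simp add: Field_seg)
  ultimately have "tpow R I (Suc m) 0 = (\<Inter>x \<in> Field ?r. transfinite_power R I (init_seg ?r x))"
    unfolding tpow_def
    by (intro transfinite_power_limit Well_order_init_seg Well_order_omega_squared) auto
  also have "\<dots> = (\<Inter>i\<in>{..m}. \<Inter>j. tpow R I i j)"
    by (auto simp: Field_seg tpow_seg less_Suc_eq_le)
  finally show ?thesis .
qed

lemma tpow_omega_squared: "transfinite_power R I omega_squared = (\<Inter>m. \<Inter>n. tpow R I m n)"
proof -
  have "\<not> is_max omega_squared x" for x
  proof
    assume "is_max omega_squared x"
    then have "((fst x, Suc (snd x)), x) \<in> omega_squared" by (simp add: is_max_def)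
    then show False by (cases x) (simp add: omega_squared_def)
  qed
  then show ?thesis
    by (subst transfinite_power_limit[OF Well_order_omega_squared]) (auto simp: tpow_def)
qed

lemma (in ring) ideal_tpow:
  assumes I: "ideal I R"
  shows "ideal (tpow R I m n) R"
proof (induction m arbitrary: n rule: less_induct)
  case (less m)
  show ?case
  proof (induction n)
    case 0
    show ?case
    proof (cases m)
      case 0
      then show ?thesis by (simp add: tpow_0_0 oneideal)
    next
      case (Suc m')
      have "ideal (\<Inter>((\<lambda>(i, j). tpow R I i j) ` ({..m'} \<times> UNIV))) R"
        by (rule i_Intersect) (use less Suc in auto)
      moreover have "\<Inter>((\<lambda>(i, j). tpow R I i j) ` ({..m'} \<times> UNIV)) = tpow R I m 0"
        by (auto simp: Suc tpow_limit)
      ultimately show ?thesis by simp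
    qed
  next
    case (Suc n)
    then show ?case unfolding tpow_Suc by (intro add_ideals ideal_prod_is_ideal I)
  qed
qed

lemma tpow_antitone: "i < m \<Longrightarrow> tpow R I m 0 \<subseteq> tpow R I i j"
  by (cases m) (auto simp: tpow_limit)

lemma (in ring) tpow_mult_I:
  assumes I: "ideal I R" and v: "v \<in> tpow R I m n" and i: "i \<in> I"
  shows "v \<otimes> i \<in> tpow R I m (Suc n)" "i \<otimes> v \<in> tpow R I m (Suc n)"
proof -
  note J = ideal_tpow[OF I, of m n]
  have zero: "\<zero> \<in> tpow R I m n \<cdot> I" "\<zero> \<in> I \<cdot> tpow R I m n"
    using additive_subgroup.zero_closed[OF ideal.axioms(1)] ideal_prod_is_ideal[OF I J] ideal_prod_is_ideal[OF J I]
    by blast+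
  have "v \<in> carrier R" "i \<in> carrier R" using v i ideal.Icarr[OF J] ideal.Icarr[OF I] by auto
  moreover have "v \<otimes> i \<in> tpow R I m n \<cdot> I" "i \<otimes> v \<in> I \<cdot> tpow R I m n"
    using v i by (auto intro: ideal_prod.prod)
  ultimately show "v \<otimes> i \<in> tpow R I m (Suc n)" "i \<otimes> v \<in> tpow R I m (Suc n)"
    unfolding tpow_Suc set_add_def' using zero by force+
qed

lemma (in ring) mult_ideal_prod:
  assumes v: "v \<in> carrier R" and K: "ideal K R" and A: "ideal A R" and B: "ideal B R"
    and mem: "\<And>a b. a \<in> A \<Longrightarrow> b \<in> B \<Longrightarrow> (v \<otimes> a) \<otimes> b \<in> K" and q: "q \<in> A \<cdot> B"
  shows "v \<otimes> q \<in> K"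
  using q
proof (induction rule: ideal_prod.induct)
  case (prod a b)
  then show ?case using mem m_assoc[OF v ideal.Icarr[OF A] ideal.Icarr[OF B]] by simp
next
  case (sum s1 s2)
  have "s1 \<in> carrier R" "s2 \<in> carrier R" using sum(1,2) ideal_prod_in_carrier[OF A B] by auto
  then have "v \<otimes> (s1 \<oplus> s2) = v \<otimes> s1 \<oplus> v \<otimes> s2" by (rule r_distr) (rule v)
  then show ?case
    using additive_subgroup.a_closed[OF ideal.axioms(1)[OF K] sum(3,4)] by simp
qed

text \<open>
  The products \<open>v (i j)\<close> and \<open>v (j i)\<close> with \<open>i\<close> in \<open>I\<close> are both reassociated to the left, which
  uses up one factor of \<open>I\<close> on the right of \<open>v\<close>.
\<close>

lemma (in ring) tpow_mult_finite:
  assumes I: "ideal I R"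
  shows "v \<in> tpow R I m k \<Longrightarrow> q \<in> tpow R I 0 n \<Longrightarrow> v \<otimes> q \<in> tpow R I m (k + n)"
proof (induction n arbitrary: v k q)
  case 0
  then show ?case using ideal.I_r_closed[OF ideal_tpow[OF I]] by (simp add: tpow_0_0)
next
  case (Suc n)
  note J = ideal_tpow[OF I, of 0 n] and K = ideal_tpow[OF I, of m "k + Suc n"]
  have v: "v \<in> carrier R" by (rule ideal.Icarr[OF ideal_tpow[OF I] Suc(2)])
  obtain q1 q2 where q: "q1 \<in> tpow R I 0 n \<cdot> I" "q2 \<in> I \<cdot> tpow R I 0 n" "q = q1 \<oplus> q2"
    using Suc(3) unfolding tpow_Suc set_add_def' by blast
  have "v \<otimes> q1 \<in> tpow R I m (k + Suc n)"
  proof (rule mult_ideal_prod[OF v K J I _ q(1)])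
    fix j i assume "j \<in> tpow R I 0 n" "i \<in> I"
    then show "(v \<otimes> j) \<otimes> i \<in> tpow R I m (k + Suc n)"
      using tpow_mult_I(1)[OF I Suc(1)[OF Suc(2)]] by simp
  qed
  moreover have "v \<otimes> q2 \<in> tpow R I m (k + Suc n)"
  proof (rule mult_ideal_prod[OF v K I J _ q(2)])
    fix i j assume "i \<in> I" "j \<in> tpow R I 0 n"
    then show "(v \<otimes> i) \<otimes> j \<in> tpow R I m (k + Suc n)"
      using Suc(1)[OF tpow_mult_I(1)[OF I Suc(2)]] by simp
  qed
  ultimately have "v \<otimes> q1 \<oplus> v \<otimes> q2 \<in> tpow R I m (k + Suc n)"
    by (rule additive_subgroup.a_closed[OF ideal.axioms(1)[OF K]])
  moreover have "q1 \<in> carrier R" "q2 \<in> carrier R"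
    using q ideal_prod_in_carrier[OF J I] ideal_prod_in_carrier[OF I J] by auto
  ultimately show ?case using r_distr[OF _ _ v] q(3) by simp
qed

text \<open>
  If \<open>q\<close> lies in every finite power, then \<open>v q\<close> lies in \<open>I\<^bsup>\<omega>m+n\<^esup>\<close> for every \<open>n\<close>, hence
  in the next limit power.
\<close>

lemma (in ring) tpow_mult_omega:
  assumes I: "ideal I R" and v: "v \<in> tpow R I m 0" and q: "\<And>n. q \<in> tpow R I 0 n"
  shows "v \<otimes> q \<in> tpow R I (Suc m) 0"
  unfolding tpow_limit
proof (intro INT_I)
  fix i j assume i: "i \<in> {..m}"
  have qc: "q \<in> carrier R" using q[of 0] by (simp add: tpow_0_0)
  show "v \<otimes> q \<in> tpow R I i j"
  proof (cases "i = m")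
    case True
    then show ?thesis using tpow_mult_finite[OF I v q[of j]] by simp
  next
    case False
    then have "v \<in> tpow R I i j" using i v tpow_antitone[of i m R I j] by auto
    then show ?thesis by (rule ideal.I_r_closed[OF ideal_tpow[OF I] _ qc])
  qed
qed

text \<open>
  At the limit \<open>\<omega> (m + 1)\<close> the exponents \<open>\<omega> m + n\<close> are cofinal, so \<open>G\<close> has to be
  compared with these only.
\<close>

lemma (in ring) tpow_upper:
  assumes "carrier R \<subseteq> G 0 0"
    and add: "\<And>m n p q. p \<in> G m n \<Longrightarrow> q \<in> G m n \<Longrightarrow> p \<oplus> q \<in> G m n"
    and mult: "\<And>m n p i. p \<in> G m n \<Longrightarrow> i \<in> I \<Longrightarrow> p \<otimes> i \<in> G m (Suc n)"
      "\<And>m n p i. p \<in> G m n \<Longrightarrow> i \<in> I \<Longrightarrow> i \<otimes> p \<in> G m (Suc n)"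
    and lim: "\<And>m. (\<Inter>n. G m n) \<subseteq> G (Suc m) 0"
  shows "tpow R I m n \<subseteq> G m n"
proof -
  have step: "tpow R I m n \<subseteq> G m n" if "tpow R I m 0 \<subseteq> G m 0" for m n
  proof (induction n)
    case (Suc n)
    have "q \<in> G m (Suc n)" if "q \<in> tpow R I m n \<cdot> I" for q
      using that
    proof (induction rule: ideal_prod.induct)
      case (prod p i)
      then show ?case using Suc by (intro mult(1)) auto
    qed (rule add)
    moreover have "q \<in> G m (Suc n)" if "q \<in> I \<cdot> tpow R I m n" for q
      using that
    proof (induction rule: ideal_prod.induct)
      case (prod i p)
      then show ?case using Suc by (intro mult(2)) auto
    qed (rule add)
    ultimately show ?case unfolding tpow_Suc set_add_def' by (auto intro: add)
  qed (fact that)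
  show ?thesis
  proof (induction m arbitrary: n)
    case 0
    show ?case by (rule step) (simp add: tpow_0_0 assms(1))
  next
    case (Suc m)
    have "tpow R I (Suc m) 0 \<subseteq> (\<Inter>n. G m n)"
      using Suc by (auto simp: tpow_limit)
    from step[OF subset_trans[OF this lim]] show ?case .
  qed
qed

lemma (in ring) is_transfinite_length_omega_squaredI:
  assumes I: "ideal I R" and strict: "\<And>m n. tpow R I m (Suc n) \<noteq> tpow R I m n"
    and zero: "(\<Inter>m. \<Inter>n. tpow R I m n) \<subseteq> {\<zero>}"
  shows "is_transfinite_length R I omega_squared"
  unfolding is_transfinite_length_def
proof (intro conjI allI impI)
  show "Well_order omega_squared" by (rule Well_order_omega_squared)
  have "\<zero> \<in> tpow R I m n" for m n
    using additive_subgroup.zero_closed[OF ideal.axioms(1)[OF ideal_tpow[OF I]]] .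
  then have TP0: "transfinite_power R I omega_squared = {\<zero>}"
    using zero unfolding tpow_omega_squared by blast
  have prods: "{\<zero>} \<cdot> I = {\<zero>}" "I \<cdot> {\<zero>} = {\<zero>}"
    using ideal_prod_inter[OF zeroideal I] ideal_prod_inter[OF I zeroideal]
      additive_subgroup.zero_closed[OF ideal.axioms(1)[OF ideal_prod_is_ideal[OF zeroideal I]]]
      additive_subgroup.zero_closed[OF ideal.axioms(1)[OF ideal_prod_is_ideal[OF I zeroideal]]]
    by blast+
  show "transfinite_power R I omega_squared = transfinite_power R I (ord_suc omega_squared)"
    unfolding transfinite_power_suc[OF Well_order_omega_squared] TP0 prods by (simp add: set_add_def')
  fix s :: "(nat \<times> nat) rel" assume "s <o omega_squared"
  moreover have s: "Well_order s" using \<open>s <o omega_squared\<close> by (auto simp: ordLess_def)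
  ultimately obtain x where "s =o init_seg omega_squared x"
    using ordLess_iff_ordIso_Restr[OF Well_order_omega_squared s] by (auto simp: init_seg_def)
  then obtain m n where "s =o init_seg omega_squared (m, n)" by (cases x) auto
  then have "transfinite_power R I s = tpow R I m n"
    unfolding tpow_def by (rule transfinite_power_ordIso)
  then show "transfinite_power R I s \<noteq> transfinite_power R I (ord_suc s)"
    using strict[of m n] unfolding transfinite_power_suc[OF s] by (simp add: tpow_Suc)
qed


section \<open>An element of all finite powers\<close>

text \<open>
  The geometric series, truncated.
\<close>

lemma approx_inverse:
  fixes a :: "'a::ring_1"
  shows "\<exists>q. (1 + a) * q = 1 - (- a) ^ n \<and> q * (1 + a) = 1 - (- a) ^ n"
proof (induction n)
  case 0
  show ?case by (rule exI[of _ 0]) simp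
next
  case (Suc n)
  then obtain q where q: "(1 + a) * q = 1 - (- a) ^ n" "q * (1 + a) = 1 - (- a) ^ n" by blast
  have "(- a) ^ n * a = - ((- a) ^ Suc n)" unfolding power_Suc2 by simp
  moreover have "(1 + a) * (q + (- a) ^ n) = (1 + a) * q + (- a) ^ n + a * (- a) ^ n"
    "(q + (- a) ^ n) * (1 + a) = q * (1 + a) + (- a) ^ n + (- a) ^ n * a"
    by (simp_all add: algebra_simps)
  ultimately show ?case
    unfolding q by (intro exI[of _ "q + (- a) ^ n"]) simp
qed

text \<open>
  With \<open>P\<close> and \<open>Q\<close> inverse to \<open>A\<close> and \<open>Y\<close> modulo \<open>S\<close>, put \<open>u = P D\<close>.  Then \<open>C\<close> is congruent to
  \<open>u Y\<close>, so that \<open>b u Y\<close> and \<open>u x Y\<close> are both congruent to \<open>b C\<close>; cancelling \<open>Y\<close> gives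
  \<open>w = b u - u x\<close> in \<open>S\<close>, and \<open>A b\<^sup>2 C - D x\<^sup>2 Y\<close> is congruent to \<open>A w x Y\<close>.
\<close>

lemma second_relation_cong:
  fixes S :: "'a::ring_1 set" and A C D x y Y :: 'a
  assumes add: "\<And>p q. p \<in> S \<Longrightarrow> q \<in> S \<Longrightarrow> p + q \<in> S"
    and left: "\<And>p q. p \<in> S \<Longrightarrow> q * p \<in> S" and right: "\<And>p q. p \<in> S \<Longrightarrow> p * q \<in> S"
    and P: "A * P - 1 \<in> S" "P * A - 1 \<in> S" and Q: "Y * Q - 1 \<in> S"
    and r0: "A * C - D * Y \<in> S" and r1: "A * b * C - D * x * Y \<in> S"
  shows "A * b * b * C - D * x * x * Y \<in> S"
proof -
  have diff: "p - q \<in> S" if "p \<in> S" "q \<in> S" for p q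
    using add[OF that(1) left[OF that(2), of "- 1"]] by simp
  define w where "w = b * P * D - P * D * x"
  have "w * Y = b * (P * A - 1) * C - (P * A - 1) * b * C - b * P * (A * C - D * Y)
      + P * (A * b * C - D * x * Y)"
    by (simp add: w_def algebra_simps)
  also have "\<dots> \<in> S" by (intro add diff left right P r0 r1)
  finally have "w * Y * Q - w * (Y * Q - 1) \<in> S"
    by (rule diff[OF right left[OF Q]])
  then have "w \<in> S" by (simp add: algebra_simps)
  have "A * b * b * C - D * x * x * Y = A * w * x * Y - A * b * (P * A - 1) * b * C
      + A * b * P * (A * b * C - D * x * Y) + (A * P - 1) * D * x * x * Y"
    by (simp add: w_def algebra_simps)
  also have "\<dots> \<in> S" by (intro add diff left right P r1 \<open>w \<in> S\<close>)
  finally show ?thesis .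
qed

text \<open>
  If \<open>a\<^sup>n\<close> and \<open>y\<^sup>n\<close> vanish modulo \<open>S\<close>, then \<open>1 + a\<close> and \<open>1 + y\<close> are invertible modulo \<open>S\<close>.
\<close>

lemma err_elt_2_in:
  fixes S :: "(generator, 'k::field) free_algebra set"
  assumes add: "\<And>p q. p \<in> S \<Longrightarrow> q \<in> S \<Longrightarrow> p + q \<in> S"
    and left: "\<And>p q. p \<in> S \<Longrightarrow> q * p \<in> S" and right: "\<And>p q. p \<in> S \<Longrightarrow> p * q \<in> S"
    and rel: "rel \<subseteq> S" and a: "gen Ga ^ n \<in> S" and y: "gen Gy ^ n \<in> S"
  shows "err_elt 2 \<in> S"
proof -
  have neg: "- (p ^ n) \<in> S \<and> - ((- p) ^ n) \<in> S" if "p ^ n \<in> S" for p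
    using left[OF that, of "- 1"] left[OF that, of "- ((- 1) ^ n)"] power_minus[of p n] by simp
  obtain P where P: "(1 + gen Ga) * P = 1 - (- gen Ga :: (generator, 'k) free_algebra) ^ n"
    "P * (1 + gen Ga) = 1 - (- gen Ga) ^ n" using approx_inverse by blast
  obtain Q where Q: "(1 + gen Gy) * Q = 1 - (- gen Gy :: (generator, 'k) free_algebra) ^ n"
    using approx_inverse by blast
  have "(1 + gen Ga) * gen Gb * gen Gb * (1 + gen Gc) - (1 + gen Gd) * gen Gx * gen Gx * (1 + gen Gy) \<in> S"
  proof (rule second_relation_cong[where P = P and Q = Q, OF add left right])
    have "err_elt 0 \<in> S" "err_elt 1 \<in> S" using rel err_elt_in_rel[of 0] err_elt_in_rel[of 1] by auto
    then show "(1 + gen Ga) * (1 + gen Gc) - (1 + gen Gd) * (1 + gen Gy) \<in> S"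
      "(1 + gen Ga) * gen Gb * (1 + gen Gc) - (1 + gen Gd) * gen Gx * (1 + gen Gy) \<in> S"
      by (simp_all add: err_elt_def)
  qed (use neg[OF a] neg[OF y] in \<open>simp_all add: P Q\<close>)
  then show ?thesis by (simp add: err_elt_def power2_eq_square mult.assoc)
qed


section \<open>Transfinite powers of the augmentation ideal\<close>

definition A0_of :: "(generator, 'k::field) free_algebra \<Rightarrow> (generator, 'k) free_algebra set" where
  "A0_of p = relation_ideal +>\<^bsub>P_ring\<^esub> p"

lemma A0_of_hom:
  "(A0_of :: (generator, 'k::field) free_algebra \<Rightarrow> (generator, 'k) free_algebra set) \<in> ring_hom P_ring A0"
  using ideal.rcos_ring_hom[OF ideal_relation_ideal] by (simp add: A0_of_def[abs_def] A0_def)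

lemma A0_of_mult: "A0_of p \<otimes>\<^bsub>A0\<^esub> A0_of q = A0_of (p * q)"
  and A0_of_add: "A0_of p \<oplus>\<^bsub>A0\<^esub> A0_of q = A0_of (p + q)"
  using ring_hom_mult[OF A0_of_hom, of p q] ring_hom_add[OF A0_of_hom, of p q]
  by (simp_all add: P_ring_def ring_of_type_algebra_def)

lemma carrier_A0: "carrier A0 = range A0_of"
  by (auto simp: A0_def FactRing_def A_RCOSETS_def' A0_of_def P_ring_def ring_of_type_algebra_def)

lemma A0_of_eq_iff: "A0_of p = A0_of q \<longleftrightarrow> p - q \<in> rel"
proof -
  have A0_of: "A0_of p = {r. r - p \<in> rel}" for p :: "(generator, 'a) free_algebra"
  proof -
    have "A0_of p = (\<lambda>h. h + p) ` rel"
      by (auto simp: A0_of_def a_r_coset_def' P_ring_def ring_of_type_algebra_def)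
    also have "\<dots> = {r. r - p \<in> rel}" by (force simp: image_iff algebra_simps)
    finally show ?thesis .
  qed
  show ?thesis
  proof
    assume "A0_of p = A0_of q"
    then have "p \<in> A0_of q" using A0_of[of p] by auto
    then show "p - q \<in> rel" by (simp add: A0_of)
  next
    assume pq: "p - q \<in> rel"
    have "r - p \<in> rel \<longleftrightarrow> r - q \<in> rel" for r
      using rel_add[OF _ pq, of "r - p"] rel_diff[OF _ pq, of "r - q"] by auto
    then show "A0_of p = A0_of q" by (simp add: A0_of)
  qed
qed

lemma zero_A0: "\<zero>\<^bsub>A0\<^esub> = (A0_of 0 :: (generator, 'k::field) free_algebra set)"
  using ring_hom_zero[OF A0_of_hom[where 'k = 'k] ring_P_ring ring_A0]
  by (simp add: P_ring_def ring_of_type_algebra_def)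

lemma A0_of_filt_iff: "A0_of p \<in> A0_of ` filt m n \<longleftrightarrow> p \<in> filt m n"
proof
  assume "A0_of p \<in> A0_of ` filt m n"
  then obtain q where "q \<in> filt m n" "p - q \<in> rel" by (auto simp: A0_of_eq_iff)
  then show "p \<in> filt m n" using filt_rel by blast
qed (rule imageI)

lemma A0_augmentation_eq: "A0_augmentation (A0_of p) = P_augmentation p"
  by (simp add: A0_of_def A0_augmentation_coset)

lemma A0_augmentation_ideal_eq: "A0_augmentation_ideal = A0_of ` {p. P_augmentation p = 0}"
  by (auto simp: A0_augmentation_ideal_def a_kernel_def' carrier_A0 A0_augmentation_eq ring_of_type_algebra_def)

lemma one_A0: "\<one>\<^bsub>A0\<^esub> = (A0_of 1 :: (generator, 'k::field) free_algebra set)"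
  using ring_hom_one[OF A0_of_hom[where 'k = 'k]] by (simp add: P_ring_def ring_of_type_algebra_def)

lemma A0_augmentation_hom:
  "(A0_augmentation :: (generator, 'k::field) free_algebra set \<Rightarrow> 'k) \<in> ring_hom A0 ring_of_type_algebra"
  by (rule ring_hom_memI)
    (auto simp: carrier_A0 A0_of_mult A0_of_add one_A0 A0_augmentation_eq ring_of_type_algebra_def
      P_augmentation_def eval_free_mult eval_free_add)

lemma ideal_A0_augmentation_ideal:
  "ideal (A0_augmentation_ideal :: (generator, 'k::field) free_algebra set set) A0"
  unfolding A0_augmentation_ideal_def
  by (rule ring_hom_ring.kernel_is_ideal[OF ring_hom_ringI2[OF ring_A0 ring_from_type_algebra A0_augmentation_hom]])

context
  fixes I :: "(generator, 'k::field) free_algebra set set"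
  defines "I \<equiv> A0_augmentation_ideal"
begin

interpretation A0: ring "A0 :: (generator, 'k::field) free_algebra set ring"
  by (rule ring_A0)

lemma ideal_I: "ideal I A0"
  by (simp add: I_def ideal_A0_augmentation_ideal)

lemma tpow_A0_upper: "tpow A0 I m n \<subseteq> A0_of ` filt m n"
proof (rule A0.tpow_upper)
  show "carrier A0 \<subseteq> A0_of ` (filt 0 0 :: (generator, 'k) free_algebra set)"
    by (simp add: carrier_A0 filt_0_0)
  show "(\<Inter>n. A0_of ` filt m n) \<subseteq> A0_of ` (filt (Suc m) 0 :: (generator, 'k) free_algebra set)" for m
  proof
    fix K :: "(generator, 'k) free_algebra set" assume K: "K \<in> (\<Inter>n. A0_of ` filt m n)"
    then obtain p where p: "K = A0_of p" by blast
    have "p \<in> filt m n" for n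
      using K A0_of_filt_iff[of p m n] unfolding p by blast
    then show "K \<in> A0_of ` filt (Suc m) 0" using filt_Inter p by blast
  qed
  show "K \<otimes>\<^bsub>A0\<^esub> L \<in> A0_of ` filt m (Suc n)"
    if "K \<in> A0_of ` filt m n" "L \<in> I" for m n and K L :: "(generator, 'k) free_algebra set"
    using that
    by (auto simp: I_def A0_augmentation_ideal_eq A0_of_mult intro!: imageI filt_mult_augmentation(1))
  show "L \<otimes>\<^bsub>A0\<^esub> K \<in> A0_of ` filt m (Suc n)"
    if "K \<in> A0_of ` filt m n" "L \<in> I" for m n and K L :: "(generator, 'k) free_algebra set"
    using that
    by (auto simp: I_def A0_augmentation_ideal_eq A0_of_mult intro!: imageI filt_mult_augmentation(2))
  show "K \<oplus>\<^bsub>A0\<^esub> L \<in> A0_of ` filt m n"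
    if "K \<in> A0_of ` filt m n" "L \<in> A0_of ` filt m n" for m n and K L :: "(generator, 'k) free_algebra set"
    using that by (auto simp: A0_of_add intro!: imageI filt_add)
qed

lemma gen_in_I: "A0_of (gen g) \<in> I"
  by (auto simp: I_def A0_augmentation_ideal_eq P_augmentation_def eval_free_gen)

lemma gen_power_in_tpow: "A0_of (gen g ^ n) \<in> tpow A0 I 0 n"
proof (induction n)
  case 0
  show ?case by (simp add: tpow_0_0 carrier_A0)
next
  case (Suc n)
  show ?case using A0.tpow_mult_I(2)[OF ideal_I Suc gen_in_I[of g]] by (simp add: A0_of_mult)
qed

lemma err_elt_2_in_tpow: "A0_of (err_elt 2) \<in> tpow A0 I 0 n"
proof -
  note J = A0.ideal_tpow[OF ideal_I, of 0 n]
  have "err_elt 2 \<in> {p. A0_of p \<in> tpow A0 I 0 n}"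
  proof (rule err_elt_2_in[where n = n])
    show "rel \<subseteq> {p. A0_of p \<in> tpow A0 I 0 n}"
    proof
      fix p :: "(generator, 'k) free_algebra" assume "p \<in> rel"
      then have "A0_of p = \<zero>\<^bsub>A0\<^esub>" by (simp add: zero_A0 A0_of_eq_iff)
      then show "p \<in> {p. A0_of p \<in> tpow A0 I 0 n}"
        using additive_subgroup.zero_closed[OF ideal.axioms(1)[OF J]] by simp
    qed
    fix p q :: "(generator, 'k) free_algebra"
    assume p: "p \<in> {p. A0_of p \<in> tpow A0 I 0 n}"
    have q: "A0_of q \<in> carrier A0" by (simp add: carrier_A0)
    show "q * p \<in> {p. A0_of p \<in> tpow A0 I 0 n}" "p * q \<in> {p. A0_of p \<in> tpow A0 I 0 n}"
      using ideal.I_l_closed[OF J _ q] ideal.I_r_closed[OF J _ q] p by (simp_all flip: A0_of_mult)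
    assume "q \<in> {p. A0_of p \<in> tpow A0 I 0 n}"
    with p show "p + q \<in> {p. A0_of p \<in> tpow A0 I 0 n}"
      using additive_subgroup.a_closed[OF ideal.axioms(1)[OF J]] by (simp flip: A0_of_add)
  qed (simp_all add: gen_power_in_tpow)
  then show ?thesis by simp
qed

lemma witness_in_tpow: "A0_of (err_elt 2 ^ m * gen Ga ^ n) \<in> tpow A0 I m n"
proof (induction n)
  case 0
  show ?case
  proof (induction m)
    case 0
    show ?case by (simp add: tpow_0_0 carrier_A0)
  next
    case (Suc m)
    show ?case
      using A0.tpow_mult_omega[OF ideal_I Suc err_elt_2_in_tpow] by (simp only: A0_of_mult power_Suc2 mult_1_right power_0)
  qed
next
  case (Suc n)
  show ?case
    using A0.tpow_mult_I(1)[OF ideal_I Suc gen_in_I[of Ga]]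
    by (simp only: A0_of_mult power_Suc2 mult.assoc)
qed

lemma transfinite_length_A0: "is_transfinite_length A0 I omega_squared"
proof (rule A0.is_transfinite_length_omega_squaredI[OF ideal_I])
  show "tpow A0 I m (Suc n) \<noteq> tpow A0 I m n" for m n
  proof
    assume "tpow A0 I m (Suc n) = tpow A0 I m n"
    then have "A0_of (err_elt 2 ^ m * gen Ga ^ n) \<in> A0_of ` (filt m (Suc n) :: (generator, 'k) free_algebra set)"
      using witness_in_tpow[of m n] tpow_A0_upper[of m "Suc n"] by blast
    then show False
      using witness_not_filt A0_of_filt_iff by blast
  qed
  show "(\<Inter>m. \<Inter>n. tpow A0 I m n) \<subseteq> {\<zero>\<^bsub>A0\<^esub>}"
  proof
    fix K assume K: "K \<in> (\<Inter>m. \<Inter>n. tpow A0 I m n)"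
    then obtain p where p: "K = A0_of p" using tpow_A0_upper by blast
    have "p \<in> filt m 0" for m
      using K tpow_A0_upper[of m 0] A0_of_filt_iff[of p m 0] unfolding p by blast
    then have "p \<in> rel" using filt_Inter_all by blast
    then show "K \<in> {\<zero>\<^bsub>A0\<^esub>}" by (simp add: p zero_A0 A0_of_eq_iff)
  qed
qed

end

theorem theorem3:
  shows "is_transfinite_length (A0 :: (generator, 'k::field) free_algebra set ring)
           A0_augmentation_ideal omega_squared"
  by (rule transfinite_length_A0)

end
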